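(* Let $d\ge 1$ and $N\ge 3$ be integers, $N=p_1^{a_1}p_2^{a_2}\cdots p_s^{a_s}$ with primes $p_1<p_2<\cdots<p_s$ and exponents $a_l\ge 1$. (i) If $2\nmid N$, then $0$ is an eigenvalue of $T^d_N$ if and only if $2d\in\mathbb{N}p_1+\cdots+\mathbb{N}p_s$. (ii) If $2\mid N$ and $d$ is even, then $0$ is an eigenvalue of $T^d_N$. (iii) If $2\mid N$, $d$ is odd, $s\ge 2$ and $p_2\le d$, then $0$ is an eigenvalue of $T^d_N$. (iv) If $2\mid N$, $d$ is odd, $s\ge 2$ and $p_2>d$, then $0$ is an eigenvalue of $T^d_N$ if and only if $4\mid N$.
   Context: Here $\mathbb{N}=\{0,1,2,\dots\}$, and $\mathbb{N}p_1+\cdots+\mathbb{N}p_s$ is the set of all $\sum_l b_lp_l$ with $b_l\in\mathbb{N}$. For integers $N\ge 3$ and $d\ge 1$, $T^d_N$ is the Cayley graph of $(\mathbb{Z}/N\mathbb{Z})^d$ with generating set $\{\pm e_1,\dots,\pm e_d\}$, $e_i$ being the canonical basis vectors. The eigenvalues of $T^d_N$ are those of its adjacency matrix, namely the numbers $2\sum_{j=1}^d\cos\frac{2k_j\pi}{N}$ for $(k_1,\dots,k_d)\in(\mathbb{Z}/N\mathbb{Z})^d$. *)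

theory Defs
  imports
    "HOL-Algebra.Product_Groups"
    "HOL-Computational_Algebra.Primes"
    "Graph_Theory.Pair_Digraph"
    "Jordan_Normal_Form.Char_Poly"
begin

definition cayley_graph :: "('a, 'b) monoid_scheme \<Rightarrow> 'a set \<Rightarrow> 'a pair_pre_digraph" where
  "cayley_graph G S =
     \<lparr>pverts = carrier G, parcs = {(x, x \<otimes>\<^bsub>G\<^esub> s) | x s. x \<in> carrier G \<and> s \<in> S}\<rparr>"

text \<open>Matrices of \<^theory>\<open>Jordan_Normal_Form.Matrix\<close> are indexed by natural numbers, so the
  adjacency matrix is taken with respect to an enumeration of the vertices.  By
  \<open>eigenvalue_adjacency_matrix_iff\<close> below, its eigenvalues do not depend on the enumeration.\<close>

definition adjacency_matrix :: "'a pair_pre_digraph \<Rightarrow> 'a list \<Rightarrow> complex mat" where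
  "adjacency_matrix G vs =
     mat (length vs) (length vs) (\<lambda>(i, j). if (vs ! i, vs ! j) \<in> parcs G then 1 else 0)"

definition graph_eigenvalue :: "'a pair_pre_digraph \<Rightarrow> complex \<Rightarrow> bool" where
  "graph_eigenvalue G k \<longleftrightarrow>
     (\<exists>vs. distinct vs \<and> set vs = pverts G \<and> eigenvalue (adjacency_matrix G vs) k)"

definition torus_group :: "nat \<Rightarrow> nat \<Rightarrow> (nat \<Rightarrow> int) monoid" where
  "torus_group d N = product_group {1..d} (\<lambda>_. integer_mod_group N)"

definition basis_vector :: "nat \<Rightarrow> nat \<Rightarrow> nat \<Rightarrow> int" where
  "basis_vector d i = (\<lambda>j\<in>{1..d}. if j = i then 1 else 0)"

definition torus_graph :: "nat \<Rightarrow> nat \<Rightarrow> (nat \<Rightarrow> int) pair_pre_digraph" where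
  "torus_graph d N =
     cayley_graph (torus_group d N)
       (\<Union>i\<in>{1..d}. {basis_vector d i, inv\<^bsub>torus_group d N\<^esub> (basis_vector d i)})"

lemma eigenvalue_adjacency_matrix_iff:
  assumes vs: "distinct vs" "set vs = pverts G"
  shows "eigenvalue (adjacency_matrix G vs) k \<longleftrightarrow>
    (\<exists>f. (\<exists>x\<in>pverts G. f x \<noteq> 0) \<and>
         (\<forall>x\<in>pverts G. (\<Sum>y | y \<in> pverts G \<and> (x, y) \<in> parcs G. f y) = k * f x))"
    (is "?L \<longleftrightarrow> ?R")
proof -
  let ?n = "length vs" and ?A = "adjacency_matrix G vs"
  have dim: "dim_row ?A = ?n" "dim_col ?A = ?n" by (auto simp: adjacency_matrix_def)
  have fin: "finite (pverts G)" using vs(2) by (metis finite_set)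
  have row: "(?A *\<^sub>v vec ?n (\<lambda>i. f (vs ! i))) $ i =
      (\<Sum>y | y \<in> pverts G \<and> (vs ! i, y) \<in> parcs G. f y)" if "i < ?n" for f i
  proof -
    have "(?A *\<^sub>v vec ?n (\<lambda>i. f (vs ! i))) $ i =
        (\<Sum>j<?n. if (vs ! i, vs ! j) \<in> parcs G then f (vs ! j) else 0)"
      using that by (auto simp: adjacency_matrix_def scalar_prod_def atLeast0LessThan
          intro!: sum.cong)
    also have "\<dots> = (\<Sum>y\<in>pverts G. if (vs ! i, y) \<in> parcs G then f y else 0)"
      using bij_betw_nth[OF vs(1) refl vs(2)[symmetric]]
      by (rule sum.reindex_bij_betw)
    also have "\<dots> = (\<Sum>y | y \<in> pverts G \<and> (vs ! i, y) \<in> parcs G. f y)"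
      using fin by (subst sum.inter_filter [symmetric]) simp_all
    finally show ?thesis .
  qed
  have all: "(\<forall>x\<in>pverts G. P x) \<longleftrightarrow> (\<forall>i<?n. P (vs ! i))" for P
    using vs(2) by (metis in_set_conv_nth)
  have ex: "(\<exists>x\<in>pverts G. P x) \<longleftrightarrow> (\<exists>i<?n. P (vs ! i))" for P
    using vs(2) by (metis in_set_conv_nth)
  have key: "eigenvector ?A (vec ?n (\<lambda>i. f (vs ! i))) k \<longleftrightarrow>
      (\<exists>x\<in>pverts G. f x \<noteq> 0) \<and>
      (\<forall>x\<in>pverts G. (\<Sum>y | y \<in> pverts G \<and> (x, y) \<in> parcs G. f y) = k * f x)" for f
    unfolding all ex eigenvector_def dim
    by (auto simp: vec_eq_iff row dim simp del: index_mult_mat_vec)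
  show ?thesis
  proof
    assume ?L
    then obtain v where v: "eigenvector ?A v k" by (auto simp: eigenvalue_def)
    define f where "f x = v $ (the_inv_into {..<?n} ((!) vs) x)" for x
    have "inj_on ((!) vs) {..<?n}" using vs(1) by (simp add: inj_on_nth)
    then have "v = vec ?n (\<lambda>i. f (vs ! i))"
      using v by (auto simp: eigenvector_def dim f_def the_inv_into_f_f vec_eq_iff)
    then show ?R using v key[of f] by auto
  next
    assume ?R
    then show ?L using key by (auto simp: eigenvalue_def)
  qed
qed

end

theory Submission
  imports Defs "HOL-Number_Theory.Cong"
begin

text \<open>
  Diagonalising by characters, \<open>0\<close> is an eigenvalue iff \<open>\<Sum>j. z j + 1 / z j = 0\<close> for some
  \<open>N\<close>-th roots of unity \<open>z 1, \<dots>, z d\<close>, so everything is about vanishing sums of roots of unity.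
  Splitting such a sum along the cosets of the \<open>m/p\<close>-th roots of unity in the \<open>m\<close>-th ones, Galois
  conjugation shows that the partial sums all vanish (\<open>p\<^sup>2\<close> divides \<open>m\<close>) or, once rotated into the
  \<open>m/p\<close>-th roots of unity, all agree (\<open>p\<^sup>2\<close> does not divide \<open>m\<close>).  By induction on \<open>m\<close> this
  yields the theorem of Lam and Leung that the length of a vanishing sum is a combination of the
  primes dividing \<open>m\<close>.  In the last part \<open>d\<close> is smaller than all odd primes dividing \<open>N\<close>, so
  Lam--Leung excludes vanishing sums of odd length at most \<open>d\<close>; the symmetry \<open>z \<mapsto> 1 / z\<close> and a parity
  count produce such a sum from an odd symmetric one.
\<close>

section \<open>Galois conjugation of sums of roots of unity\<close>

text \<open>The inner binomial coefficients are multiples of \<open>q\<close>. The setting is a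
  general commutative ring because both integers and integer polynomials are substituted
  below.\<close>

lemma prime_dvd_freshman:
  fixes x y :: "'a :: comm_ring_1"
  assumes "prime q"
  shows "of_nat q dvd (x + y) ^ q - (x ^ q + y ^ q)"
proof -
  have q: "q > 0" using assms by (simp add: prime_gt_0_nat)
  have "(x + y) ^ q = (\<Sum>k\<le>q. of_nat (q choose k) * x ^ k * y ^ (q - k))"
    by (rule binomial_ring)
  also have "{..q} = insert 0 (insert q {1..<q})" using q by auto
  also have "(\<Sum>k\<in>\<dots>. of_nat (q choose k) * x ^ k * y ^ (q - k)) =
      x ^ q + y ^ q + (\<Sum>k\<in>{1..<q}. of_nat (q choose k) * x ^ k * y ^ (q - k))"
    using q by simp
  finally have "(x + y) ^ q - (x ^ q + y ^ q) =
      (\<Sum>k\<in>{1..<q}. of_nat (q choose k) * x ^ k * y ^ (q - k))" by simp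
  moreover have "of_nat q dvd (\<Sum>k\<in>{1..<q}. of_nat (q choose k) * x ^ k * y ^ (q - k))"
  proof (rule dvd_sum)
    fix k assume "k \<in> {1..<q}"
    then have "q dvd (q choose k)" using assms by (intro dvd_choose_prime) auto
    then have "(of_nat q :: 'a) dvd of_nat (q choose k)" by (auto elim!: dvdE)
    then show "of_nat q dvd of_nat (q choose k) * x ^ k * y ^ (q - k)" by simp
  qed
  ultimately show ?thesis by simp
qed

lemma prime_dvd_fermat_int:
  assumes "prime q"
  shows "int q dvd a ^ q - a"
proof -
  have q: "q > 0" using assms by (simp add: prime_gt_0_nat)
  have nat: "int q dvd int n ^ q - int n" for n
  proof (induction n)
    case 0 then show ?case using q by (simp add: zero_power)
  next
    case (Suc n)
    have "int (Suc n) ^ q - int (Suc n) =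
        ((int n + 1) ^ q - (int n ^ q + 1 ^ q)) + (int n ^ q - int n)"
      by (simp add: add.commute)
    then show ?case using Suc prime_dvd_freshman[OF assms, of "int n" 1]
      by (metis dvd_add of_nat_id of_nat_eq_iff)
  qed
  show ?thesis
  proof (cases "a \<ge> 0")
    case True then show ?thesis using nat[of "nat a"] by simp
  next
    case False
    define n where "n = nat (- a)"
    have a: "a = - int n" using False by (simp add: n_def)
    \<comment> \<open>Here \<open>int n + a = 0\<close>, so \<open>a ^ q\<close> is congruent to
      \<open>- (int n ^ q)\<close> without separating \<open>q = 2\<close> from odd
      \<open>q\<close>.\<close>
    have "int q dvd (int n + a) ^ q - (int n ^ q + a ^ q)"
      using prime_dvd_freshman[OF assms, of "int n" a] by simp
    then have "int q dvd - (int n ^ q + a ^ q)" using q by (simp add: a zero_power)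
    then have "int q dvd int n ^ q + a ^ q" by (metis dvd_minus_iff)
    from dvd_diff[OF this nat[of n]] show ?thesis by (simp add: a)
  qed
qed

text \<open>Modulo \<open>q\<close>, the \<open>q\<close>-th power is additive and, by Fermat, fixes
  constants, so on polynomials it amounts to substituting \<open>X ^ q\<close> for \<open>X\<close>.
  The induction splits \<open>f\<close> as \<open>a + X * g\<close>.\<close>

lemma prime_dvd_pcompose_power:
  fixes f :: "int poly"
  assumes "prime q"
  shows "of_nat q dvd f \<circ>\<^sub>p (monom 1 q) - f ^ q"
proof (induction f)
  case 0 then show ?case using assms by (simp add: prime_gt_0_nat zero_power)
next
  case (pCons a g)
  have e: "pCons a g = [:a:] + monom 1 1 * g" by (simp add: monom_altdef)
  have 1: "of_nat q dvd ([:a:] + monom 1 1 * g) ^ q - ([:a:] ^ q + (monom 1 1 * g) ^ q)"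
    using prime_dvd_freshman[OF assms, of "[:a:]" "monom 1 1 * g"] by simp
  have 2: "of_nat q dvd [:a:] ^ q - [:a:]"
  proof -
    have "[:int q:] dvd [:a ^ q - a:]"
      using prime_dvd_fermat_int[OF assms, of a] by simp
    moreover have "[:a:] ^ q - [:a:] = [:a ^ q - a:]" by (simp add: poly_const_pow)
    ultimately show ?thesis by (simp add: of_nat_poly)
  qed
  have 3: "of_nat q dvd monom 1 q * (g \<circ>\<^sub>p monom 1 q - g ^ q)"
    using pCons by simp
  have "pCons a g \<circ>\<^sub>p monom 1 q - pCons a g ^ q =
     monom 1 q * (g \<circ>\<^sub>p monom 1 q - g ^ q) - ([:a:] ^ q - [:a:])
     - (([:a:] + monom 1 1 * g) ^ q - ([:a:] ^ q + (monom 1 1 * g) ^ q))"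
    unfolding e[symmetric]
    by (simp add: pcompose_pCons power_mult_distrib monom_power algebra_simps)
  then show ?case using 1 2 3 by (metis dvd_diff)
qed

section \<open>Minimal polynomials of roots of unity and conjugation\<close>

definition ipoly :: "int poly \<Rightarrow> complex \<Rightarrow> complex" where
  "ipoly f z = poly (map_poly of_int f) z"

lemma ipoly_simps [simp]:
  "ipoly 0 z = 0"
  "ipoly 1 z = 1"
  "ipoly [:c:] z = of_int c"
  "ipoly (of_nat n) z = of_nat n"
  "ipoly (monom c n) z = of_int c * z ^ n"
  "ipoly (f + g) z = ipoly f z + ipoly g z"
  "ipoly (f - g) z = ipoly f z - ipoly g z"
  "ipoly (f * g) z = ipoly f z * ipoly g z"
  "ipoly (Polynomial.smult c f) z = of_int c * ipoly f z"
  "ipoly (f ^ n) z = ipoly f z ^ n"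
  "ipoly (f \<circ>\<^sub>p g) z = ipoly f (ipoly g z)"
  by (simp_all add: ipoly_def hom_distribs of_nat_poly poly_monom poly_pcompose)

lemma ipoly_power_prime:
  assumes "prime q"
  obtains u where "\<And>z. ipoly f (z ^ q) = ipoly f z ^ q + of_nat q * ipoly u z"
proof -
  obtain u where "f \<circ>\<^sub>p (monom 1 q) - f ^ q = of_nat q * u"
    using prime_dvd_pcompose_power[OF assms, of f] by (auto elim: dvdE)
  then have "f \<circ>\<^sub>p (monom 1 q) = f ^ q + of_nat q * u" by (simp add: algebra_simps)
  then have "ipoly (f \<circ>\<^sub>p (monom 1 q)) z = ipoly (f ^ q + of_nat q * u) z" for z by simp
  then have "ipoly f (z ^ q) = ipoly f z ^ q + of_nat q * ipoly u z" for z
    by simp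
  then show ?thesis using that by blast
qed

text \<open>The primitive part of a nonzero annihilating polynomial of least degree serves as
  minimal polynomial. Pseudo-division keeps the argument over the integers, and divisibility of the
  monic \<open>X ^ m - 1\<close> makes the leading coefficient a unit.\<close>

lemma minimal_int_poly:
  assumes "z ^ m = 1" "m > 0"
  obtains h where "ipoly h z = 0" "lead_coeff h dvd 1" "h dvd monom 1 m - 1"
    "\<And>f. ipoly f z = 0 \<Longrightarrow> h dvd f" "degree h > 0"
proof -
  let ?P = "\<lambda>n. \<exists>h. h \<noteq> 0 \<and> ipoly h z = 0 \<and> degree h = n"
  have "ipoly (monom 1 m - 1) z = 0" using assms by simp
  moreover have ne: "monom 1 m - (1 :: int poly) \<noteq> 0"
    using assms by (auto simp: monom_eq_1_iff)
  ultimately have "\<exists>n. ?P n" by blast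
  define n where "n = (LEAST n. ?P n)"
  have "?P n" unfolding n_def by (rule LeastI_ex) fact
  then obtain h0 where h0: "h0 \<noteq> 0" "ipoly h0 z = 0" "degree h0 = n" by blast
  have min: "h' = 0" if "ipoly h' z = 0" "degree h' < n" for h'
    using that not_less_Least[of "degree h'" ?P] unfolding n_def by blast
  define h where "h = primitive_part h0"
  have "ipoly (Polynomial.smult (content h0) h) z = 0" using h0 by (simp add: h_def)
  then have hz: "ipoly h z = 0" using h0 by simp
  have hn: "h \<noteq> 0" "degree h = n" "content h = 1" using h0 by (auto simp: h_def)
  have dvd: "h dvd f" if f: "ipoly f z = 0" for f
  proof -
    obtain a r where ar: "pseudo_divmod f h = (a, r)" by force
    note pd = pseudo_divmod[OF hn(1) ar]
    define c where "c = lead_coeff h ^ (Suc (degree f) - degree h)"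
    have c: "c \<noteq> 0" using hn(1) by (simp add: c_def)
    have eq: "Polynomial.smult c f = h * a + r" using pd(1) unfolding c_def by simp
    have "ipoly (Polynomial.smult c f) z = ipoly (h * a + r) z" using eq by simp
    then have "ipoly r z = 0" using f hz by simp
    then have "r = 0" using pd(2) min hn by auto
    then have "h dvd Polynomial.smult c f" using eq by simp
    \<comment> \<open>Gauss's lemma: the factor \<open>c\<close> is a unit over the fraction field,
      and since \<open>h\<close> is primitive, divisibility descends to the integers.\<close>
    then have "fract_poly h dvd fract_poly (Polynomial.smult c f)" by (rule fract_poly_dvd)
    then have "fract_poly h dvd Polynomial.smult (to_fract c) (fract_poly f)" by simp
    then have "fract_poly h dvd fract_poly f" using c by (simp add: dvd_smult_iff)
    then show ?thesis by (rule fract_poly_dvdD) (use hn in simp)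
  qed
  have hd: "h dvd monom 1 m - 1" by (rule dvd) fact
  have "lead_coeff (monom 1 m - 1 :: int poly) = 1"
  proof -
    have "degree (monom 1 m - 1 :: int poly) = m"
      using assms(2) degree_add_eq_left[of "-1" "monom 1 m :: int poly"]
      by (simp add: degree_monom_eq)
    then show ?thesis using assms by simp
  qed
  then have "lead_coeff h dvd 1" using hd by (metis dvdE dvd_triv_left lead_coeff_mult)
  moreover have "degree h > 0"
  proof (rule ccontr)
    assume "\<not> degree h > 0"
    then obtain c where "h = [:c:]" by (metis degree_eq_zeroE not_gr_zero)
    then show False using hz hn by simp
  qed
  ultimately show ?thesis using that hz hd dvd by blast
qed

text \<open>Dedekind's argument, with the derivative of \<open>X ^ m - 1\<close> in place of separability
  modulo \<open>q\<close>: it shows that \<open>m\<close> would be a multiple of \<open>q\<close> in the ring generated by \<open>z\<close>.\<close>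

lemma ipoly_root_power_prime:
  assumes "z ^ m = 1" "m > 0" "prime q" "\<not> q dvd m" "ipoly f z = 0"
  shows "ipoly f (z ^ q) = 0"
proof -
  obtain h where hz: "ipoly h z = 0" and lc: "lead_coeff h dvd 1" and hd: "h dvd monom 1 m - 1"
    and dvd: "\<And>f. ipoly f z = 0 \<Longrightarrow> h dvd f" and deg: "degree h > 0"
    using minimal_int_poly[OF assms(1,2)] by metis
  obtain g where g: "monom 1 m - 1 = h * g" using hd by (auto elim: dvdE)
  have "ipoly h (z ^ q) = 0"
  proof (rule ccontr)
    assume nz: "ipoly h (z ^ q) \<noteq> 0"
    have zq: "(z ^ q) ^ m = 1" using assms(1) by (metis mult.commute power_mult power_one)
    have "ipoly (monom 1 m - 1) (z ^ q) = 0" using zq by simp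
    then have gz: "ipoly g (z ^ q) = 0" using nz by (simp add: g)
    \<comment> \<open>Differentiating \<open>X ^ m - 1 = h * g\<close> at the root
      \<open>z ^ q\<close> of \<open>g\<close> leaves only the term with \<open>h (z ^ q)\<close>,
      which is \<open>q\<close> times an integer polynomial in \<open>z\<close> because
      \<open>h z = 0\<close>. Multiplying by \<open>z ^ q\<close> turns the left side into
      \<open>m\<close>.\<close>
    have "pderiv (monom 1 m - 1 :: int poly) = pderiv (h * g)" using g by simp
    then have "monom (of_nat m) (m - 1) = h * pderiv g + g * pderiv h"
      by (simp add: pderiv_monom pderiv_mult pderiv_diff)
    then have "ipoly (monom (of_nat m) (m - 1)) (z ^ q) = ipoly (h * pderiv g + g * pderiv h) (z ^ q)"
      by simp
    then have D: "of_nat m * (z ^ q) ^ (m - 1) = ipoly h (z ^ q) * ipoly (pderiv g) (z ^ q)"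
      using gz by simp
    obtain u where u: "\<And>z. ipoly h (z ^ q) = ipoly h z ^ q + of_nat q * ipoly u z"
      using ipoly_power_prime[OF assms(3)] by metis
    have q0: "q > 0" using assms(3) by (simp add: prime_gt_0_nat)
    define w where "w = u * (pderiv g \<circ>\<^sub>p monom 1 q) * monom 1 q"
    have "of_nat m = of_nat m * (z ^ q) ^ (m - 1) * z ^ q"
    proof -
      have "(z ^ q) ^ (m - 1) * z ^ q = (z ^ q) ^ m" using assms(2) by (metis power_minus_mult)
      then show ?thesis using zq by (simp add: mult.assoc)
    qed
    also have "\<dots> = of_nat q * ipoly w z"
      unfolding D w_def using u[of z] hz q0
      by (simp add: zero_power)
    finally have mq: "of_nat m = of_nat q * ipoly w z" .
    \<comment> \<open>Reducing \<open>w\<close> modulo \<open>h\<close> gives a polynomial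
      \<open>v\<close> that vanishes at \<open>z\<close> with degree below that of \<open>h\<close>.
      So \<open>v = 0\<close>, and its constant coefficient shows that \<open>q\<close> divides
      \<open>c * m\<close> with \<open>c\<close> a unit.\<close>
    obtain a r where ar: "pseudo_divmod w h = (a, r)" by force
    have h0: "h \<noteq> 0" using deg by auto
    define c where "c = lead_coeff h ^ (Suc (degree w) - degree h)"
    have "c dvd 1" unfolding c_def using lc is_unit_power_iff by blast
    have eq: "Polynomial.smult c w = h * a + r" and r: "r = 0 \<or> degree r < degree h"
      using pseudo_divmod[OF h0 ar] c_def by auto
    have "ipoly (Polynomial.smult c w) z = ipoly (h * a + r) z" using eq by simp
    then have cw: "of_int c * ipoly w z = ipoly r z" using hz by simp
    define v where "v = [:c * int m:] - Polynomial.smult (int q) r"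
    have "ipoly v z = of_int c * of_nat m - of_nat q * ipoly r z"
      by (simp add: v_def)
    also have "\<dots> = 0" unfolding cw[symmetric] using mq by simp
    finally have "h dvd v" by (rule dvd)
    moreover have "degree v < degree h"
      using r deg unfolding v_def by (intro degree_diff_less) auto
    ultimately have "v = 0" using dvd_imp_degree_le[of h v] by linarith
    then have "coeff [:c * int m:] 0 = coeff (Polynomial.smult (int q) r) 0" unfolding v_def by simp
    then have "int q dvd c * int m" by simp
    then have "int q dvd int m" using \<open>c dvd 1\<close>
      by (metis dvd_mult_cancel_left dvd_mult_unit_iff' dvd_trans)
    then show False using assms(4) by simp
  qed
  moreover obtain b where "f = h * b" using dvd[OF assms(5)] by (auto elim: dvdE)
  ultimately show ?thesis by simp
qed

text \<open>The prime factors of \<open>k\<close> are applied one at a time; each power of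
  \<open>z\<close> is again an \<open>m\<close>-th root of unity, and \<open>z\<close> need not be
  primitive.\<close>

lemma ipoly_root_power_coprime:
  assumes "z ^ m = 1" "m > 0" "coprime k m" "k > 0" "ipoly f z = 0"
  shows "ipoly f (z ^ k) = 0"
  using assms(3,4,1,5)
proof (induction k arbitrary: z rule: prime_divisors_induct)
  case (factor q k)
  have "ipoly f (z ^ q) = 0"
  proof (rule ipoly_root_power_prime)
    show "\<not> q dvd m" using factor
      by (metis coprime_absorb_left coprime_mult_left_iff not_prime_unit)
  qed (use factor assms(2) in auto)
  moreover have "(z ^ q) ^ m = 1" using factor(5) by (metis mult.commute power_mult power_one)
  ultimately show ?case using factor.IH[of "z ^ q"] factor.prems
    by (simp add: power_mult)
qed auto

section \<open>Roots of unity of prime order and Fourier inversion\<close>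

lemma power_eq_one_coprime:
  fixes w :: complex
  assumes "w ^ a = 1" "w ^ b = 1" "coprime a b" "a > 0"
  shows "w = 1"
proof -
  obtain x y where "a * x = b * y + 1"
    using bezout_nat[of a b] assms by auto
  then have "w ^ (a * x) = w ^ (b * y) * w" by simp
  then show ?thesis using assms by (simp add: power_mult)
qed

lemma power_cong_exponent:
  fixes w :: complex
  assumes "w ^ n = 1" "[k = j] (mod n)"
  shows "w ^ k = w ^ j"
proof -
  have "w ^ i = w ^ (i mod n)" for i
  proof -
    have "w ^ i = w ^ (n * (i div n) + i mod n)" by simp
    also have "\<dots> = w ^ (i mod n)" using assms(1) by (simp only: power_add power_mult power_one mult_1)
    finally show ?thesis .
  qed
  then show ?thesis using assms(2) by (metis cong_def)
qed

lemma prime_root_unity_power_eq_iff: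
  fixes w :: complex
  assumes "prime p" "w ^ p = 1" "w \<noteq> 1" "i < p" "j < p"
  shows "w ^ i = w ^ j \<longleftrightarrow> i = j"
proof -
  have "i = j" if "w ^ i = w ^ j" "i \<le> j" "j < p" for i j
  proof (rule ccontr)
    assume "i \<noteq> j"
    have "w \<noteq> 0" using assms by (metis prime_gt_0_nat power_0_left zero_neq_one less_numeral_extra(3))
    moreover have "w ^ j = w ^ i * w ^ (j - i)" using \<open>i \<le> j\<close> by (metis le_add_diff_inverse power_add)
    ultimately have "w ^ (j - i) = 1" using that by simp
    moreover have "coprime (j - i) p"
      using that \<open>i \<noteq> j\<close> assms(1)
      by (metis coprime_commute diff_is_0_eq le_neq_implies_less less_imp_diff_less nat_dvd_not_less
          not_le prime_imp_coprime zero_less_diff)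
    ultimately show False using power_eq_one_coprime[of w "j - i" p] assms that \<open>i \<noteq> j\<close> by auto
  qed
  then show ?thesis using assms by (metis nat_le_linear)
qed

lemma bij_betw_prime_root_unity_powers:
  fixes w :: complex
  assumes "prime p" "w ^ p = 1" "w \<noteq> 1"
  shows "bij_betw (\<lambda>i. w ^ i) {..<p} {z. z ^ p = 1}"
proof -
  have p: "p > 0" using assms(1) by (simp add: prime_gt_0_nat)
  have inj: "inj_on (\<lambda>i. w ^ i) {..<p}"
    using prime_root_unity_power_eq_iff[OF assms] by (auto simp: inj_on_def)
  have sub: "(\<lambda>i. w ^ i) ` {..<p} \<subseteq> {z. z ^ p = 1}"
    using assms(2) by (auto simp flip: power_mult) (metis mult.commute power_mult power_one)
  have "(\<lambda>i. w ^ i) ` {..<p} = {z. z ^ p = 1}"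
  proof (rule card_subset_eq[OF _ sub])
    show "finite {z::complex. z ^ p = 1}" using p by (intro finite_roots_unity) simp
    show "card ((\<lambda>i. w ^ i) ` {..<p}) = card {z::complex. z ^ p = 1}"
      using p by (simp add: card_image[OF inj] card_roots_unity_eq)
  qed
  then show ?thesis using inj by (simp add: bij_betw_def)
qed

lemma sum_powers_root_unity:
  fixes w :: complex
  assumes "w ^ p = 1"
  shows "(\<Sum>j<p. w ^ j) = (if w = 1 then of_nat p else 0)"
  using one_diff_power_eq[of w p] assms by (cases "w = 1") simp_all

text \<open>A function on the integers modulo \<open>p\<close> whose nontrivial Fourier coefficients
  vanish is constant. The conclusion keeps the trivial coefficient, so that its vanishing, where
  available, makes the function zero.\<close>

lemma prime_fourier_inversion:
  fixes w :: complex
  assumes "prime p" "w ^ p = 1" "w \<noteq> 1"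
    and "\<And>j. 0 < j \<Longrightarrow> j < p \<Longrightarrow> (\<Sum>l<p. a l * w ^ (l * j)) = 0"
    and "i < p"
  shows "of_nat p * a i = (\<Sum>l<p. a l)"
proof -
  have p: "p > 0" using assms(1) by (simp add: prime_gt_0_nat)
  have w0: "w \<noteq> 0" using assms p by (metis power_0_left zero_neq_one less_numeral_extra(3))
  have "(\<Sum>l<p. a l) = (\<Sum>j<p. if j = 0 then (\<Sum>l<p. a l) else 0)"
    using p by simp
  \<comment> \<open>The added terms with \<open>j > 0\<close> are zero by assumption. The exponent
    \<open>j * (p - i)\<close> is a natural number standing for \<open>- (i * j)\<close>.\<close>
  also have "\<dots> = (\<Sum>j<p. w ^ (j * (p - i)) * (\<Sum>l<p. a l * w ^ (l * j)))"
    using assms(4) by (intro sum.cong) auto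
  also have "\<dots> = (\<Sum>j<p. \<Sum>l<p. a l * (w ^ (l + (p - i))) ^ j)"
    unfolding sum_distrib_left
    by (intro sum.cong refl) (simp add: algebra_simps flip: power_add power_mult)
  also have "\<dots> = (\<Sum>l<p. a l * (\<Sum>j<p. (w ^ (l + (p - i))) ^ j))"
    by (subst sum.swap) (simp add: sum_distrib_left)
  also have "\<dots> = (\<Sum>l<p. if l = i then of_nat p * a i else 0)"
  proof (intro sum.cong refl)
    fix l assume l: "l \<in> {..<p}"
    have 1: "(w ^ (l + (p - i))) ^ p = 1"
      using assms(2) by (metis mult.commute power_mult power_one)
    have "w ^ (l + (p - i)) * w ^ i = w ^ l"
      using assms(2,5) by (simp add: flip: power_add) (simp add: power_add)
    then have "w ^ (l + (p - i)) = 1 \<longleftrightarrow> w ^ i = w ^ l"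
      using w0 by (metis mult_cancel_right1 power_not_zero)
    also have "\<dots> \<longleftrightarrow> l = i"
      using prime_root_unity_power_eq_iff[OF assms(1-3)] assms(5) l by auto
    finally show "a l * (\<Sum>j<p. (w ^ (l + (p - i))) ^ j) = (if l = i then of_nat p * a i else 0)"
      using sum_powers_root_unity[OF 1] by simp
  qed
  also have "\<dots> = of_nat p * a i" using assms(5) by simp
  finally show ?thesis by simp
qed

section \<open>Splitting sums along cosets of roots of unity\<close>

definition roots_of_unity :: "nat \<Rightarrow> complex set" where
  "roots_of_unity m = {z. z ^ m = 1}"

lemma roots_of_unity_mono: "a dvd b \<Longrightarrow> roots_of_unity a \<subseteq> roots_of_unity b"
  by (auto simp: roots_of_unity_def elim!: dvdE) (simp add: power_mult)

text \<open>All members are powers of one primitive root \<open>w\<close>, so each sum is an integer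
  polynomial at \<open>w\<close>, and its value at \<open>w ^ k\<close> is the sum of
  \<open>k\<close>-th powers. The difference of the two polynomials vanishes at \<open>w\<close>,
  hence at \<open>w ^ k\<close>.\<close>

lemma galois_conjugate_sum_mset_eq:
  assumes "m > 0" "set_mset X \<subseteq> roots_of_unity m" "set_mset Y \<subseteq> roots_of_unity m"
    and "\<Sum>\<^sub># X = \<Sum>\<^sub># Y" "coprime k m" "k > 0"
  shows "(\<Sum>z\<in>#X. z ^ k) = (\<Sum>z\<in>#Y. z ^ k)"
proof -
  define w where "w = cis (2 * pi / real m)"
  have wm: "w ^ m = 1" using assms(1) by (simp add: w_def DeMoivre)
  have pow: "\<exists>j. z = w ^ j" if "z \<in> roots_of_unity m" for z
  proof -
    have "z \<in> (\<lambda>k. cis (2 * pi * real k / real m)) ` {..<m}"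
      using bij_betw_imp_surj_on[OF bij_betw_roots_unity[OF assms(1)]] that
      by (simp only: roots_of_unity_def)
    then obtain j where "z = cis (2 * pi * real j / real m)" by (rule imageE)
    then have "z = w ^ j" by (simp add: w_def DeMoivre mult.commute)
    then show ?thesis ..
  qed
  have poly: "\<exists>f. \<forall>k. ipoly f (w ^ k) = (\<Sum>z\<in>#M. z ^ k)" if "set_mset M \<subseteq> roots_of_unity m" for M
    using that
  proof (induction M)
    case empty
    have "\<forall>k. ipoly 0 (w ^ k) = (\<Sum>z\<in>#{#}. z ^ k)" by simp
    then show ?case ..
  next
    case (add z M)
    then obtain f j where "\<forall>k. ipoly f (w ^ k) = (\<Sum>z\<in>#M. z ^ k)" "z = w ^ j"
      using pow[of z] by auto
    then have "\<forall>k. ipoly (monom 1 j + f) (w ^ k) = (\<Sum>z\<in>#add_mset z M. z ^ k)"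
      by (simp add: mult.commute flip: power_mult)
    then show ?case ..
  qed
  obtain f g where f: "\<And>k. ipoly f (w ^ k) = (\<Sum>z\<in>#X. z ^ k)"
    and g: "\<And>k. ipoly g (w ^ k) = (\<Sum>z\<in>#Y. z ^ k)"
    using poly[OF assms(2)] poly[OF assms(3)] by metis
  have "ipoly (f - g) w = 0" using f[of 1] g[of 1] assms(4) by simp
  then have "ipoly (f - g) (w ^ k) = 0"
    using wm assms(1,5,6) by (intro ipoly_root_power_coprime)
  then show ?thesis by (simp add: f g)
qed

text \<open>The part of \<open>M\<close> in the coset \<open>w ^ i * roots_of_unity n\<close>, rotated back into
  \<open>roots_of_unity n\<close>.\<close>

definition component :: "complex \<Rightarrow> nat \<Rightarrow> nat \<Rightarrow> complex multiset \<Rightarrow> complex multiset" where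
  "component w n i M = image_mset (\<lambda>z. z / w ^ i) (filter_mset (\<lambda>z. z ^ n = w ^ (n * i)) M)"

lemma component_empty [simp]: "component w n i {#} = {#}"
  by (simp add: component_def)

text \<open>Since \<open>w ^ n\<close> has order \<open>p\<close>, the powers \<open>w ^ i\<close>
  with \<open>i < p\<close> represent the cosets of \<open>roots_of_unity n\<close> in
  \<open>roots_of_unity (p * n)\<close>.\<close>

locale prime_decomposition =
  fixes p n :: nat and w :: complex
  assumes prime: "prime p" and n_pos: "n > 0" and root: "w ^ (p * n) = 1" and primitive: "w ^ n \<noteq> 1"
begin

lemma p_pos: "p > 0" using prime by (simp add: prime_gt_0_nat)

lemma w_nonzero: "w \<noteq> 0"
  using root p_pos n_pos by (auto simp: zero_power)

lemma ex1_class: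
  assumes "z \<in> roots_of_unity (p * n)"
  shows "\<exists>!i. i < p \<and> z ^ n = w ^ (n * i)"
proof -
  have bij: "bij_betw (\<lambda>i. (w ^ n) ^ i) {..<p} {z. z ^ p = 1}"
    using root primitive
    by (intro bij_betw_prime_root_unity_powers prime) (simp_all add: mult.commute flip: power_mult)
  have "z ^ n \<in> {z. z ^ p = 1}"
    using assms by (simp add: roots_of_unity_def mult.commute flip: power_mult)
  then have "z ^ n \<in> (\<lambda>i. (w ^ n) ^ i) ` {..<p}"
    by (simp only: bij_betw_imp_surj_on[OF bij])
  then obtain i where i: "i < p" "z ^ n = (w ^ n) ^ i" by auto
  have "j = i" if "j < p" "z ^ n = (w ^ n) ^ j" for j
    using inj_onD[OF bij_betw_imp_inj_on[OF bij], of j i] i that by simp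
  then show ?thesis using i by (metis power_mult)
qed

lemma component_roots: "set_mset (component w n i M) \<subseteq> roots_of_unity n"
proof
  fix y assume "y \<in># component w n i M"
  then obtain z where "z ^ n = w ^ (n * i)" "y = z / w ^ i" by (auto simp: component_def)
  moreover have "(w ^ i) ^ n = w ^ (n * i)" by (metis mult.commute power_mult)
  ultimately show "y \<in> roots_of_unity n"
    using w_nonzero by (simp add: roots_of_unity_def power_divide)
qed

text \<open>The summand \<open>g\<close> is arbitrary so that the same identity yields sizes and
  sums of \<open>k\<close>-th powers.\<close>

lemma sum_mset_components:
  fixes g :: "complex \<Rightarrow> 'a :: comm_monoid_add"
  assumes "set_mset M \<subseteq> roots_of_unity (p * n)"
  shows "(\<Sum>z\<in>#M. g z) = (\<Sum>i<p. \<Sum>y\<in>#component w n i M. g (w ^ i * y))"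
  using assms
proof (induction M)
  case empty
  then show ?case by simp
next
  case (add z M)
  obtain k where k: "k < p" "z ^ n = w ^ (n * k)" "\<And>i. i < p \<Longrightarrow> z ^ n = w ^ (n * i) \<Longrightarrow> i = k"
    using ex1_class[of z] add.prems by auto
  have "(\<Sum>i<p. \<Sum>y\<in>#component w n i (add_mset z M). g (w ^ i * y)) =
      (\<Sum>i<p. (if i = k then g z else 0) + (\<Sum>y\<in>#component w n i M. g (w ^ i * y)))"
    using k w_nonzero by (intro sum.cong refl) (auto simp: component_def)
  also have "\<dots> = g z + (\<Sum>i<p. \<Sum>y\<in>#component w n i M. g (w ^ i * y))"
    using k(1) by (simp add: sum.distrib)
  finally show ?case using add by simp
qed

lemma size_components:
  assumes "set_mset M \<subseteq> roots_of_unity (p * n)"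
  shows "size M = (\<Sum>i<p. size (component w n i M))"
  using sum_mset_components[OF assms, of "\<lambda>_. 1 :: nat"] by simp

text \<open>An exponent \<open>k\<close> congruent to 1 modulo \<open>n\<close> fixes the rotated
  components and only twists the coset representatives, so conjugation yields Fourier coefficients
  of the differences of component sums.\<close>

lemma component_sum_conjugate:
  assumes X: "set_mset X \<subseteq> roots_of_unity (p * n)" and Y: "set_mset Y \<subseteq> roots_of_unity (p * n)"
    and eq: "\<Sum>\<^sub># X = \<Sum>\<^sub># Y" and k: "coprime k (p * n)" "[k = 1] (mod n)" "k > 0"
  shows "(\<Sum>i<p. (\<Sum>\<^sub># (component w n i X) - \<Sum>\<^sub># (component w n i Y)) * w ^ (i * k)) = 0"
proof -
  have *: "(\<Sum>z\<in>#M. z ^ k) = (\<Sum>i<p. \<Sum>\<^sub># (component w n i M) * w ^ (i * k))"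
    if M: "set_mset M \<subseteq> roots_of_unity (p * n)" for M
  proof -
    have "(\<Sum>z\<in>#M. z ^ k) = (\<Sum>i<p. \<Sum>y\<in>#component w n i M. (w ^ i * y) ^ k)"
      by (rule sum_mset_components[OF M])
    also have "\<dots> = (\<Sum>i<p. \<Sum>y\<in>#component w n i M. w ^ (i * k) * y)"
    proof (intro sum.cong refl arg_cong[where f = sum_mset] image_mset_cong)
      fix i y assume "y \<in># component w n i M"
      then have "y ^ n = 1" using component_roots by (auto simp: roots_of_unity_def)
      then have "y ^ k = y" using power_cong_exponent[of y n k 1] k(2) by simp
      then show "(w ^ i * y) ^ k = w ^ (i * k) * y" by (simp add: power_mult_distrib power_mult)
    qed
    also have "\<dots> = (\<Sum>i<p. \<Sum>\<^sub># (component w n i M) * w ^ (i * k))"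
      by (simp add: mult.commute flip: sum_mset_distrib_left)
    finally show ?thesis .
  qed
  have "(\<Sum>z\<in>#X. z ^ k) = (\<Sum>z\<in>#Y. z ^ k)"
    using X Y eq k p_pos n_pos by (intro galois_conjugate_sum_mset_eq[of "p * n"]) auto
  then show ?thesis using *[OF X] *[OF Y] by (simp add: left_diff_distrib sum_subtractf)
qed

text \<open>When \<open>p\<close> divides \<open>n\<close>, every exponent \<open>1 + n * j\<close>
  is coprime to \<open>p * n\<close>. Hence all Fourier coefficients vanish, the trivial one
  included, and the differences are zero.\<close>

lemma component_sums_eq:
  assumes X: "set_mset X \<subseteq> roots_of_unity (p * n)" and Y: "set_mset Y \<subseteq> roots_of_unity (p * n)"
    and eq: "\<Sum>\<^sub># X = \<Sum>\<^sub># Y" and "p dvd n" "i < p"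
  shows "\<Sum>\<^sub># (component w n i X) = \<Sum>\<^sub># (component w n i Y)"
proof -
  define c where "c i = (\<Sum>\<^sub># (component w n i X) - \<Sum>\<^sub># (component w n i Y)) * w ^ i" for i
  have V: "(\<Sum>i<p. c i * (w ^ n) ^ (i * j)) = 0" for j
  proof -
    have "coprime (1 + n * j) (p * n)"
    proof -
      have "coprime (1 + n * j) n" 
        by (rule coprimeI) (metis dvd_add_left_iff dvd_mult2)
      then show ?thesis using \<open>p dvd n\<close> by (metis coprime_divisors coprime_mult_right_iff dvd_refl)
    qed
    moreover have "[1 + n * j = 1] (mod n)" by (metis cong_def mod_mult_self2)
    ultimately have "(\<Sum>i<p. (\<Sum>\<^sub># (component w n i X) - \<Sum>\<^sub># (component w n i Y)) * w ^ (i * (1 + n * j))) = 0"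
      using component_sum_conjugate[OF X Y eq, of "1 + n * j"] by linarith
    moreover have "w ^ (i * (1 + n * j)) = w ^ i * (w ^ n) ^ (i * j)" for i
    proof -
      have "i * (1 + n * j) = i + n * (i * j)" by (simp add: algebra_simps)
      then show ?thesis by (simp only: power_add power_mult)
    qed
    ultimately show ?thesis unfolding c_def by (simp add: mult.assoc)
  qed
  have "(w ^ n) ^ p = 1" using root by (metis mult.commute power_mult)
  then have "of_nat p * c i = (\<Sum>l<p. c l)"
    using V primitive \<open>i < p\<close> by (intro prime_fourier_inversion[OF prime, of "w ^ n"])
  also have "\<dots> = 0" using V[of 0] by simp
  finally show ?thesis using p_pos w_nonzero by (simp add: c_def)
qed

text \<open>The Chinese remainder theorem supplies exponents that are 1 modulo \<open>n\<close> and
  \<open>j\<close> modulo \<open>p\<close>, coprime to \<open>p\<close> only for nonzero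
  \<open>j\<close>. The trivial Fourier coefficient stays uncontrolled, so the differences are
  merely constant.\<close>

lemma component_sum_diff_const:
  assumes X: "set_mset X \<subseteq> roots_of_unity (p * n)" and Y: "set_mset Y \<subseteq> roots_of_unity (p * n)"
    and eq: "\<Sum>\<^sub># X = \<Sum>\<^sub># Y" and "\<not> p dvd n" "w ^ p = 1" "i < p" "j < p"
  shows "\<Sum>\<^sub># (component w n i X) - \<Sum>\<^sub># (component w n i Y) =
    \<Sum>\<^sub># (component w n j X) - \<Sum>\<^sub># (component w n j Y)"
proof -
  define c where "c i = \<Sum>\<^sub># (component w n i X) - \<Sum>\<^sub># (component w n i Y)" for i
  have cop: "coprime n p" using \<open>\<not> p dvd n\<close> prime by (metis coprime_commute prime_imp_coprime)
  have V: "(\<Sum>i<p. c i * w ^ (i * j)) = 0" if j: "0 < j" "j < p" for j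
  proof -
    obtain k where k: "[k = 1] (mod n)" "[k = j] (mod p)"
      using binary_chinese_remainder_nat[OF cop] by metis
    have "coprime k n" using k(1) by (metis cong_imp_coprime cong_sym coprime_1_left)
    moreover have "coprime k p"
    proof -
      have "coprime j p" using j prime
        by (metis coprime_commute nat_dvd_not_less prime_imp_coprime)
      then show ?thesis using k(2) by (metis cong_imp_coprime cong_sym)
    qed
    ultimately have cp: "coprime k (p * n)" by simp
    moreover have "k > 0"
    proof (rule ccontr)
      assume "\<not> k > 0"
      then have "p = 1" using \<open>coprime k p\<close> by simp
      then show False using prime by simp
    qed
    ultimately have "(\<Sum>i<p. c i * w ^ (i * k)) = 0"
      unfolding c_def using k(1) by (intro component_sum_conjugate X Y eq)
    moreover have "w ^ (i * k) = w ^ (i * j)" for i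
      using \<open>w ^ p = 1\<close> k(2) by (intro power_cong_exponent[of w p] cong_scalar_left)
    ultimately show ?thesis by simp
  qed
  have "w \<noteq> 1" using primitive by auto
  have "of_nat p * c i = (\<Sum>l<p. c l)" if "i < p" for i
    using V that by (intro prime_fourier_inversion[OF prime \<open>w ^ p = 1\<close> \<open>w \<noteq> 1\<close>])
  then have "of_nat p * c i = of_nat p * c j" using assms(6,7) by simp
  then show ?thesis using p_pos by (simp add: c_def)
qed

end

text \<open>Counting roots shows that \<open>w\<close> exists. For \<open>p\<close> not dividing
  \<open>n\<close> it can be taken among the \<open>p\<close>-th roots of unity, as
  \<open>component_sum_diff_const\<close> requires.\<close>

lemma prime_decomposition_exists:
  assumes "prime p" "n > 0"
  obtains w where "prime_decomposition p n w" "\<not> p dvd n \<Longrightarrow> w ^ p = 1"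
proof (cases "p dvd n")
  case True
  have "n < p * n" using assms by (simp add: prime_gt_Suc_0_nat)
  have "card {z::complex. z ^ n = 1} = n" "card {z::complex. z ^ (p * n) = 1} = p * n"
    using assms by (simp_all add: card_roots_unity_eq prime_gt_0_nat)
  then have "\<not> {z::complex. z ^ (p * n) = 1} \<subseteq> {z. z ^ n = 1}"
    using card_mono[of "{z::complex. z ^ n = 1}" "{z. z ^ (p * n) = 1}"] \<open>n < p * n\<close> assms
    by (auto simp: finite_roots_unity)
  then obtain w :: complex where "w ^ (p * n) = 1" "w ^ n \<noteq> 1" by blast
  then show ?thesis using that True assms by (auto simp: prime_decomposition_def)
next
  case False
  have "card {z::complex. z ^ p = 1} = p"
    using assms by (simp add: card_roots_unity_eq prime_gt_0_nat)
  then have "\<not> {z::complex. z ^ p = 1} \<subseteq> {1}"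
    using card_mono[of "{1::complex}" "{z. z ^ p = 1}"] prime_gt_1_nat[OF assms(1)] by auto
  then obtain w :: complex where w: "w ^ p = 1" "w \<noteq> 1" by blast
  then have "w ^ n \<noteq> 1"
    using power_eq_one_coprime[of w p n] False assms by (auto simp: prime_imp_coprime prime_gt_0_nat)
  moreover have "w ^ (p * n) = 1" using w by (simp add: power_mult)
  ultimately show ?thesis using that w assms by (auto simp: prime_decomposition_def)
qed

section \<open>Lengths of vanishing sums\<close>

lemma sum_mset_roots_of_unity_1:
  assumes "set_mset M \<subseteq> roots_of_unity 1"
  shows "\<Sum>\<^sub># M = of_nat (size M)"
  using assms by (induction M) (simp_all add: roots_of_unity_def)

text \<open>The counting step of \<open>lam_leung_dichotomy\<close>: \<open>k\<close> and
  \<open>l\<close> are the component sizes of \<open>X\<close> and \<open>Y\<close>,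
  \<open>t\<close> is the least size of a \<open>Y\<close>-component opposite an empty
  \<open>X\<close>-component, and \<open>j\<close> is a component where the first alternative fails.
  Apart from \<open>j\<close>, few \<open>k i\<close> are nonzero, so many \<open>l i\<close> are at
  least \<open>t\<close>.\<close>

lemma deficit_bound:
  fixes k l :: "nat \<Rightarrow> nat"
  assumes "q < r" "r \<le> p" "(\<Sum>i<p. k i) < q" "j < p"
    and l: "\<And>i. i < p \<Longrightarrow> k i = 0 \<Longrightarrow> t \<le> l i"
    and j: "q \<le> k j + t \<or> (q - (k j + t)) * (r - 1) \<le> l j"
  shows "(q - (\<Sum>i<p. k i)) * (r - 1) \<le> (\<Sum>i<p. l i)"
proof -
  define R where "R = r - 1"
  define J where "J = {..<p} - {j}"
  define c where "c = (\<Sum>i\<in>J. k i)"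
  define A where "A = {i\<in>J. k i = 0}"
  have K: "(\<Sum>i<p. k i) = k j + c"
    using assms(4) by (simp add: c_def J_def sum.remove)
  have "card (J - A) \<le> c"
  proof -
    have "card (J - A) = (\<Sum>i\<in>J - A. 1)" by simp
    also have "\<dots> \<le> (\<Sum>i\<in>J - A. k i)" by (intro sum_mono) (auto simp: A_def)
    also have "\<dots> \<le> c" unfolding c_def by (intro sum_mono2) (auto simp: J_def)
    finally show ?thesis .
  qed
  moreover have "card J = p - 1" using assms(4) by (simp add: J_def)
  moreover have "card (J - A) = card J - card A"
    by (intro card_Diff_subset) (auto simp: A_def J_def)
  ultimately have A: "R - c \<le> card A" using assms(2) by (simp add: R_def)
  have "t * (R - c) + l j \<le> t * card A + l j" using A by simp
  also have "t * card A \<le> (\<Sum>i\<in>A. l i)"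
    using sum_bounded_below[of A t l] l by (auto simp: A_def J_def mult.commute)
  also have "\<dots> \<le> (\<Sum>i\<in>J. l i)" by (intro sum_mono2) (auto simp: A_def J_def)
  also have "(\<Sum>i\<in>J. l i) + l j = (\<Sum>i<p. l i)"
    using assms(4) by (simp add: J_def sum.remove)
  finally have sum: "t * (R - c) + l j \<le> (\<Sum>i<p. l i)" by simp
  have bounds: "k j + c < q" "q \<le> R" using assms(1,3) K by (simp_all add: R_def)
  have "int t * (int R - int c) + int (l j) = int (t * (R - c) + l j)"
    using bounds by (simp add: of_nat_diff)
  also have "\<dots> \<le> int (\<Sum>i<p. l i)" using sum by (simp only: of_nat_le_iff)
  finally have "int t * (int R - int c) + int (l j) \<le> int (\<Sum>i<p. l i)" .
  \<comment> \<open>In the first case \<open>t >= q - k j\<close> leaves the slack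
    \<open>c * (R - q + k j)\<close>; in the second the bound on \<open>l j\<close> leaves the slack
    \<open>c * (R - t)\<close>. Both are nonnegative since \<open>q <= R\<close>.\<close>
  moreover have "(int q - int (k j) - int c) * int R \<le> int t * (int R - int c) + int (l j)"
  proof (cases "q \<le> k j + t")
    case True
    have "0 \<le> int c * (int R - int q + int (k j))" using bounds by simp
    then have "(int q - int (k j) - int c) * int R \<le> (int q - int (k j)) * (int R - int c)"
      by (simp add: algebra_simps)
    also have "\<dots> \<le> int t * (int R - int c)" using True bounds by (intro mult_right_mono) auto
    finally show ?thesis by simp
  next
    case False
    have "(int q - int (k j) - int t) * int R = int ((q - (k j + t)) * R)"
      using False by (simp add: of_nat_diff)
    also have "\<dots> \<le> int (l j)" using j False by (simp only: of_nat_le_iff R_def simp_thms)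
    finally have "(int q - int (k j) - int t) * int R \<le> int (l j)" .
    moreover have "0 \<le> int c * (int R - int t)" using False bounds by simp
    ultimately show ?thesis by (simp add: algebra_simps)
  qed
  ultimately have "(int q - int (k j) - int c) * int R \<le> int (\<Sum>i<p. l i)" by linarith
  moreover have "int ((q - (k j + c)) * R) = (int q - int (k j) - int c) * int R"
    using bounds by (simp add: of_nat_diff)
  ultimately show ?thesis unfolding K R_def[symmetric] by linarith
qed

section \<open>Numerical semigroups and the Lam--Leung theorem\<close>

text \<open>An arbitrary submonoid replaces the combinations of given primes; a parity condition
  will serve as another instance.\<close>

locale nat_semigroup =
  fixes S :: "nat set"
  assumes zero: "0 \<in> S" and add: "a \<in> S \<Longrightarrow> b \<in> S \<Longrightarrow> a + b \<in> S"
begin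

lemma mult: "a \<in> S \<Longrightarrow> n * a \<in> S"
  by (induction n) (auto simp: zero add)

lemma sum: "(\<And>i. i \<in> I \<Longrightarrow> f i \<in> S) \<Longrightarrow> (\<Sum>i\<in>I. f i) \<in> S"
  by (induction I rule: infinite_finite_induct) (auto simp: zero add)

text \<open>Some \<open>b < q\<close> makes \<open>n - r * b\<close> a multiple of \<open>q\<close>.
  The bound on \<open>n\<close> puts this difference above \<open>- q\<close>, so it is
  nonnegative.\<close>

lemma sylvester:
  assumes "q \<in> S" "r \<in> S" "coprime q r" "q > 0" "(q - 1) * (r - 1) \<le> n"
  shows "n \<in> S"
proof -
  obtain b where b: "[r * b = n] (mod q)" "b < q"
  proof -
    obtain y where "[r * y = Suc 0] (mod q)"
      using cong_solve_coprime_nat[of r q] assms(3) by (auto simp: coprime_commute)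
    define x where "x = y * n"
    have "[r * x = n] (mod q)"
      using cong_scalar_right[OF \<open>[r * y = Suc 0] (mod q)\<close>, of n] by (simp add: x_def mult.assoc)
    then have "[r * (x mod q) = n] (mod q)" by (simp add: cong_def mod_mult_right_eq)
    then show ?thesis using that[of "x mod q"] assms(4) by simp
  qed
  have "r * b \<le> r * (q - 1)" using b(2) by (intro mult_left_mono) auto
  moreover have "r * (q - 1) \<le> (q - 1) * (r - 1) + (q - 1)"
    by (cases r) (simp_all add: algebra_simps)
  ultimately have le: "r * b < n + q" using assms(4,5) by linarith
  have "r * b \<le> n"
  proof (rule ccontr)
    assume *: "\<not> r * b \<le> n"
    then have "q dvd r * b - n" using b(1) by (simp add: cong_altdef_nat)
    then have "q \<le> r * b - n" using * by (intro dvd_imp_le) auto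
    then show False using le * by linarith
  qed
  then have "q dvd n - r * b" using cong_sym[OF b(1)] \<open>r * b \<le> n\<close> by (simp add: cong_altdef_nat)
  then obtain c where "n - r * b = q * c" by (auto elim: dvdE)
  then have "n = q * c + r * b" using \<open>r * b \<le> n\<close> by linarith
  then have "n = c * q + b * r" by (simp only: mult.commute)
  then show ?thesis using assms(1,2) by (simp add: add mult)
qed

text \<open>Strengthening of the Lam--Leung theorem that makes the induction work; the theorem is the case
  \<open>X = {#}\<close>, where the second alternative exceeds the Frobenius number of \<open>q\<close> and \<open>r\<close>.  Since \<open>X\<close> has
  fewer than \<open>p\<close> elements, some component of \<open>X\<close> is empty; the corresponding component of \<open>Y\<close> of
  smallest size \<open>t\<close>, added to the components of \<open>X\<close>, gives the instances of the induction
  hypothesis.\<close>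

lemma lam_leung_dichotomy:
  assumes "q < r" "m > 0"
    and "\<And>p. prime p \<Longrightarrow> p dvd m \<Longrightarrow> p \<in> S \<and> (p = q \<or> r \<le> p)"
    and "set_mset X \<subseteq> roots_of_unity m" "set_mset Y \<subseteq> roots_of_unity m"
    and "\<Sum>\<^sub># X = \<Sum>\<^sub># Y" "size X < q"
  shows "(\<exists>s\<in>S. size Y = size X + s) \<or> (q - size X) * (r - 1) \<le> size Y"
  using assms(2-)
proof (induction m arbitrary: X Y rule: less_induct)
  case (less m)
  note S = less.prems(2) and X = less.prems(3) and Y = less.prems(4)
  show ?case
  proof (cases "m = 1")
    case True
    then have "size X = size Y"
      using sum_mset_roots_of_unity_1[of X] sum_mset_roots_of_unity_1[of Y] X Y less.prems(5)
      by simp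
    then show ?thesis using zero by auto
  next
    case False
    \<comment> \<open>A prime other than \<open>q\<close> is preferred. If only \<open>q\<close>
      divides \<open>m\<close>, then \<open>m = q\<close> or the square of \<open>q\<close> divides
      \<open>m\<close>, so \<open>p = q\<close> never meets the case of \<open>n > 1\<close> prime
      to \<open>p\<close>.\<close>
    obtain p where p: "prime p" "p dvd m" "p \<noteq> q \<or> p dvd m div p \<or> m = p"
    proof (cases "\<exists>p. prime p \<and> p dvd m \<and> p \<noteq> q")
      case True
      then show ?thesis using that by blast
    next
      case only: False
      obtain p where p: "prime p" "p dvd m" using False prime_factor_nat by blast
      show ?thesis
      proof (cases "m div p = 1")
        case True
        then have "m = p" using p by (metis dvd_mult_div_cancel mult.right_neutral)
        then show ?thesis using that p by blast
      next
        case False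
        then obtain p' where p': "prime p'" "p' dvd m div p" using prime_factor_nat by blast
        then have "p' dvd m" using p by (metis dvd_div_mult_self dvd_mult2)
        then have "p' = p" using only p p' by metis
        then show ?thesis using that p p' by blast
      qed
    qed
    define n where "n = m div p"
    have m: "m = p * n" using p(2) by (simp add: n_def)
    have n: "n > 0" "n < m" using less.prems(1) p(1) by (auto simp: m prime_gt_Suc_0_nat)
    have p0: "p > 0" "p \<in> S" using S[OF p(1,2)] p(1) by (auto simp: prime_gt_0_nat)
    obtain w where w: "prime_decomposition p n w" "\<not> p dvd n \<Longrightarrow> w ^ p = 1"
      using prime_decomposition_exists[OF p(1) n(1)] by metis
    interpret prime_decomposition p n w by (rule w(1))
    define X' where "X' i = component w n i X" for i
    define Y' where "Y' i = component w n i Y" for i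
    note X = X[unfolded m] and Y = Y[unfolded m]
    have roots: "set_mset (X' i) \<subseteq> roots_of_unity n" "set_mset (Y' i) \<subseteq> roots_of_unity n" for i
      by (simp_all add: X'_def Y'_def component_roots)
    have size: "size X = (\<Sum>i<p. size (X' i))" "size Y = (\<Sum>i<p. size (Y' i))"
      using size_components[OF X] size_components[OF Y] by (simp_all add: X'_def Y'_def)
    have le: "size (X' i) \<le> size X" "size (Y' i) \<le> size Y" if "i < p" for i
      unfolding size using that by (auto intro!: member_le_sum)
    have IH: "(\<exists>s\<in>S. size B = size A + s) \<or> (q - size A) * (r - 1) \<le> size B"
      if "set_mset A \<subseteq> roots_of_unity n" "set_mset B \<subseteq> roots_of_unity n"
        "\<Sum>\<^sub># A = \<Sum>\<^sub># B" "size A < q" for A B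
      using that n S by (intro less.IH) (auto simp: m)
    show ?thesis
    proof (cases "p dvd n")
      case True
      have eq: "\<Sum>\<^sub># (X' i) = \<Sum>\<^sub># (Y' i)" if "i < p" for i
        unfolding X'_def Y'_def using component_sums_eq[OF X Y less.prems(5) True that] .
      show ?thesis
      proof (cases "\<forall>i<p. \<exists>s\<in>S. size (Y' i) = size (X' i) + s")
        case True
        then obtain s where s: "\<And>i. i < p \<Longrightarrow> s i \<in> S \<and> size (Y' i) = size (X' i) + s i" by metis
        then have "size Y = size X + (\<Sum>i<p. s i)" by (simp add: size sum.distrib)
        moreover have "(\<Sum>i<p. s i) \<in> S" using s by (intro sum) auto
        ultimately show ?thesis by blast
      next
        case False
        then obtain i where i: "i < p" "\<not> (\<exists>s\<in>S. size (Y' i) = size (X' i) + s)" by blast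
        have "size (X' i) < q" using le(1)[OF i(1)] less.prems(6) by simp
        then have "(q - size (X' i)) * (r - 1) \<le> size (Y' i)"
          using IH[OF roots eq[OF i(1)]] i(2) by blast
        moreover have "(q - size X) * (r - 1) \<le> (q - size (X' i)) * (r - 1)"
          using le(1)[OF i(1)] by (intro mult_right_mono) auto
        ultimately show ?thesis using le(2)[OF i(1)] by linarith
      qed
    next
      case False
      note const = component_sum_diff_const[OF X Y less.prems(5) False w(2)[OF False]]
      have qp: "q \<le> p" using S[OF p(1,2)] assms(1) by auto
      define Z where "Z = {i. i < p \<and> X' i = {#}}"
      have "Z \<noteq> {}"
      proof
        assume "Z = {}"
        then have "1 \<le> size (X' i)" if "i < p" for i
          using that by (auto simp: Z_def Suc_le_eq nonempty_has_size)
        then have "(\<Sum>i<p. 1) \<le> (\<Sum>i<p. size (X' i))" by (intro sum_mono) auto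
        then show False using less.prems(6) qp by (simp add: size)
      qed
      define i0 where "i0 = arg_min_on (\<lambda>i. size (Y' i)) Z"
      have fin: "finite Z" by (simp add: Z_def)
      have i0: "i0 < p" "X' i0 = {#}"
        using arg_min_if_finite(1)[OF fin \<open>Z \<noteq> {}\<close>, of "\<lambda>i. size (Y' i)"]
        by (auto simp: i0_def Z_def)
      define t where "t = size (Y' i0)"
      have t: "t \<le> size (Y' i)" if "i < p" "size (X' i) = 0" for i
        using arg_min_least[OF fin \<open>Z \<noteq> {}\<close>, of i "\<lambda>i. size (Y' i)"] that
        by (auto simp: i0_def Z_def t_def)
      \<comment> \<open>The constant difference is read off at \<open>i0\<close>, where the
        \<open>X\<close>-component is empty, and is moved to the other side.\<close>
      have shift: "\<Sum>\<^sub># (X' i + Y' i0) = \<Sum>\<^sub># (Y' i)" if "i < p" for i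
        using const[OF that i0(1)] i0(2) by (simp add: X'_def Y'_def algebra_simps)
      show ?thesis
      proof (cases "\<forall>i<p. \<exists>s\<in>S. size (Y' i) = size (X' i) + t + s")
        case True
        then obtain s where s: "\<And>i. i < p \<Longrightarrow> s i \<in> S \<and> size (Y' i) = size (X' i) + t + s i" by metis
        \<comment> \<open>Each of the \<open>p\<close> components contributes \<open>t\<close>
          additional elements, and \<open>t * p\<close> lies in \<open>S\<close> because
          \<open>p\<close> does.\<close>
        then have "size Y = size X + (t * p + (\<Sum>i<p. s i))" by (simp add: size sum.distrib)
        moreover have "t * p + (\<Sum>i<p. s i) \<in> S"
          using s p0 by (intro add mult sum) auto
        ultimately show ?thesis by blast
      next
        case bad: False
        then obtain j where j: "j < p" "\<not> (\<exists>s\<in>S. size (Y' j) = size (X' j) + t + s)" by blast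
        \<comment> \<open>For \<open>n = 1\<close> all rotated elements equal 1, so sums are sizes
          and \<open>j\<close> would satisfy the first alternative with
          \<open>s = 0\<close>.\<close>
        have "n \<noteq> 1"
        proof
          assume "n = 1"
          then have "of_nat (size (X' j + Y' i0)) = (of_nat (size (Y' j)) :: complex)"
            using shift[OF j(1)] roots by (auto simp: sum_mset_roots_of_unity_1)
          then have "size (Y' j) = size (X' j) + t + 0" by (simp add: t_def flip: of_nat_add)
          then show False using j(2) zero by blast
        qed
        then have "p \<noteq> q" using p(3) False p0 by (auto simp: n_def[symmetric] m)
        then have "r \<le> p" using S[OF p(1,2)] by blast
        \<comment> \<open>The induction hypothesis needs fewer than \<open>q\<close> elements in
          \<open>X' j + Y' i0\<close>; the first disjunct covers its failure.\<close>
        moreover have "q \<le> size (X' j) + t \<or> (q - (size (X' j) + t)) * (r - 1) \<le> size (Y' j)"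
        proof (cases "q \<le> size (X' j) + t")
          case False
          have "set_mset (X' j + Y' i0) \<subseteq> roots_of_unity n" using roots by simp
          then show ?thesis
            using IH[OF _ roots(2) shift[OF j(1)]] j(2) False by (auto simp: t_def)
        qed simp
        ultimately show ?thesis
          using deficit_bound[of q r p "\<lambda>i. size (X' i)" j t "\<lambda>i. size (Y' i)"]
            assms(1) less.prems(6) j(1) t unfolding size by auto
      qed
    qed
  qed
qed

theorem lam_leung:
  assumes "m > 0" "\<And>p. prime p \<Longrightarrow> p dvd m \<Longrightarrow> p \<in> S"
    and "set_mset M \<subseteq> roots_of_unity m" "\<Sum>\<^sub># M = 0"
  shows "size M \<in> S"
proof (cases "m = 1")
  case True
  then show ?thesis using sum_mset_roots_of_unity_1[of M] assms(3,4) zero by auto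
next
  case False
  define P where "P = {p. prime p \<and> p dvd m}"
  have fin: "finite P" using assms(1) by (intro finite_subset[OF _ finite_divisors_nat[of m]]) (auto simp: P_def)
  have "P \<noteq> {}" using False prime_factor_nat by (auto simp: P_def)
  define q where "q = Min P"
  have q: "prime q" "q dvd m" "q \<in> S"
    using Min_in[OF fin \<open>P \<noteq> {}\<close>] assms(2) by (auto simp: q_def P_def)
  \<comment> \<open>The second smallest prime divisor of \<open>m\<close>; for a prime power, a
    value so large that the second alternative of the dichotomy is impossible.\<close>
  define r where "r = (if P - {q} = {} then q + size M + 1 else Min (P - {q}))"
  have r: "r \<le> p" if "p \<in> P" "p \<noteq> q" for p
    using that fin by (auto simp: r_def)
  have "q < r"
  proof (cases "P - {q} = {}")
    case False
    then have "r \<in> P - {q}" using Min_in[of "P - {q}"] fin by (simp add: r_def)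
    then show ?thesis using Min_le[OF fin, of r] by (auto simp: q_def)
  qed (simp add: r_def)
  define X0 :: "complex multiset" where "X0 = {#}"
  have "(\<exists>s\<in>S. size M = size X0 + s) \<or> (q - size X0) * (r - 1) \<le> size M"
    using assms \<open>q < r\<close> r q by (intro lam_leung_dichotomy[of q r m]) (auto simp: X0_def P_def prime_gt_0_nat)
  then show ?thesis unfolding X0_def size_empty
  proof
    assume *: "(q - 0) * (r - 1) \<le> size M"
    have q2: "q \<ge> 2" using q(1) by (rule prime_ge_2_nat)
    show ?thesis
    proof (cases "P - {q} = {}")
      case True
      then have "size M < r - 1" using q2 by (simp add: r_def)
      also have "\<dots> \<le> q * (r - 1)" using q2 by simp
      finally show ?thesis using * by simp
    next
      case False
      then have "r \<in> P - {q}" using Min_in[of "P - {q}"] fin by (simp add: r_def)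
      then have r: "prime r" "r \<in> S" "r \<noteq> q" using assms(2) by (auto simp: P_def)
      have "coprime q r" using primes_coprime[OF q(1) r(1)] r(3) by simp
      moreover have "(q - 1) * (r - 1) \<le> size M"
      proof -
        have "(q - 1) * (r - 1) \<le> q * (r - 1)" by (intro mult_right_mono) auto
        also have "\<dots> \<le> size M" using * by simp
        finally show ?thesis .
      qed
      ultimately show ?thesis using sylvester[OF q(3) r(2)] q2 by simp
    qed
  qed auto
qed

end

section \<open>Odd sums that are symmetric under inversion\<close>

lemma sum_reflect_halve:
  fixes f :: "nat \<Rightarrow> 'a :: comm_monoid_add"
  assumes "odd p"
  shows "(\<Sum>i=1..<p. f i) = (\<Sum>i=1..p div 2. f i + f (p - i))"
proof -
  define h where "h = p div 2"
  have p: "p = 2 * h + 1" using assms by (simp add: h_def)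
  have "{1..<p} = {1..h} \<union> {h+1..<p}" "{1..h} \<inter> {h+1..<p} = {}" using p by auto
  then have "(\<Sum>i=1..<p. f i) = (\<Sum>i=1..h. f i) + (\<Sum>i=h+1..<p. f i)"
    by (simp add: sum.union_disjoint)
  also have "(\<Sum>i=h+1..<p. f i) = (\<Sum>i=1..h. f (p - i))"
    by (rule sum.reindex_bij_witness[of _ "\<lambda>i. p - i" "\<lambda>i. p - i"]) (use p in auto)
  finally show ?thesis by (simp add: sum.distrib h_def)
qed

text \<open>Lam--Leung for the numbers that are even or exceed \<open>L\<close>: an odd sum of two
  of them has an odd summand, which exceeds \<open>L\<close>.\<close>

lemma odd_vanishing_sum_size:
  assumes "m > 0" "\<And>p. prime p \<Longrightarrow> p dvd m \<Longrightarrow> p \<noteq> 2 \<Longrightarrow> L < p"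
    and "set_mset M \<subseteq> roots_of_unity m" "\<Sum>\<^sub># M = 0" "odd (size M)"
  shows "L < size M"
proof -
  interpret nat_semigroup "{k. odd k \<longrightarrow> L < k}"
    by unfold_locales auto
  have "size M \<in> {k. odd k \<longrightarrow> L < k}"
  proof (rule lam_leung[OF assms(1) _ assms(3,4)])
    fix p assume "prime p" "p dvd m"
    then show "p \<in> {k. odd k \<longrightarrow> L < k}" using assms(2)[of p] by (cases "p = 2") auto
  qed
  then show ?thesis using assms(5) by simp
qed

context prime_decomposition
begin

lemma component_union [simp]: "component w n i (A + B) = component w n i A + component w n i B"
  by (simp add: component_def)

text \<open>Inversion exchanges the cosets of \<open>w ^ i\<close> and \<open>w ^ (p - i)\<close>;
  the factor \<open>w ^ p\<close> corrects the rotation, as \<open>w ^ p\<close> may differ from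
  1.\<close>

lemma component_inverse:
  assumes "i \<le> p"
  shows "component w n (p - i) (image_mset inverse A) =
    image_mset (\<lambda>y. inverse (y * w ^ p)) (component w n i A)"
proof -
  have 1: "inverse z ^ n = w ^ (n * (p - i)) \<longleftrightarrow> z ^ n = w ^ (n * i)" for z
  proof -
    have "w ^ (n * (p - i)) * w ^ (n * i) = 1"
    proof -
      have "n * (p - i) + n * i = n * (p - i + i)" by (simp only: distrib_left)
      also have "\<dots> = p * n" using assms by simp
      finally show ?thesis using root by (metis power_add)
    qed
    then have "w ^ (n * (p - i)) = inverse (w ^ (n * i))" by (rule inverse_unique[symmetric, OF trans[OF mult.commute]])
    then show ?thesis by (simp add: power_inverse)
  qed
  have 2: "inverse z / w ^ (p - i) = inverse (z / w ^ i * w ^ p)" for z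
  proof -
    have "w ^ p = w ^ (p - i) * w ^ i" using assms by (simp flip: power_add)
    then show ?thesis using w_nonzero by (simp add: field_simps)
  qed
  show ?thesis
    by (simp only: component_def filter_mset_image_mset multiset.map_comp comp_def 1 2)
qed

text \<open>The coset with index 0 is its own inverse; \<open>component_inverse\<close> would give
  it the index \<open>p\<close>, outside the range of the decomposition.\<close>

lemma component_0_inverse:
  "component w n 0 (image_mset inverse A) = image_mset inverse (component w n 0 A)"
  by (simp add: component_def filter_mset_image_mset multiset.map_comp comp_def power_inverse)

end

text \<open>Every term is 2 or -2, so the sum is twice an integer with the parity of
  \<open>size A\<close>.\<close>

lemma odd_sum_signs_nonzero:
  assumes "set_mset A \<subseteq> roots_of_unity 2" "odd (size A)"
  shows "(\<Sum>z\<in>#A. z + inverse z) \<noteq> 0"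
proof -
  have "\<exists>k. (\<Sum>z\<in>#A. z + inverse z) = of_int (2 * k) \<and> (even k \<longleftrightarrow> even (size A))"
    using assms(1)
  proof (induction A)
    case empty
    then show ?case by (intro exI[of _ 0]) simp
  next
    case (add z A)
    then obtain k where k: "(\<Sum>z\<in>#A. z + inverse z) = of_int (2 * k)" "even k \<longleftrightarrow> even (size A)"
      by auto
    have "z = 1 \<or> z = -1" using add.prems by (auto simp: roots_of_unity_def power2_eq_1_iff)
    then show ?case
    proof
      assume "z = 1"
      then show ?case using k by (intro exI[of _ "k + 1"]) simp
    next
      assume "z = - 1"
      then show ?case using k by (intro exI[of _ "k - 1"]) simp
    qed
  qed
  then show ?thesis using assms(2) by auto
qed

text \<open>Induction removes an odd prime \<open>p\<close> from \<open>N\<close>, splitting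
  \<open>M\<close>, which is \<open>A\<close> with its inverses. If all component sums vanish,
  parity passes to component 0, where induction applies. Otherwise some component of
  \<open>M\<close> is a single sign, which turns component 0 into an odd vanishing sum that is too
  short.\<close>

lemma odd_symmetric_sum_nonzero:
  assumes "even N" "\<not> 4 dvd N" "\<And>p. prime p \<Longrightarrow> p dvd N \<Longrightarrow> p \<noteq> 2 \<Longrightarrow> size A < p"
    and "set_mset A \<subseteq> roots_of_unity N" "odd (size A)"
  shows "(\<Sum>z\<in>#A. z + inverse z) \<noteq> 0"
  using assms
proof (induction N arbitrary: A rule: less_induct)
  case (less N)
  note big = less.prems(3)
  show ?case
  proof (cases "N = 2")
    case True
    then show ?thesis using odd_sum_signs_nonzero less.prems by simp
  next
    case False
    have N0: "N > 0" using less.prems(2) by (intro Nat.gr0I) auto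
    obtain h where h: "N = 2 * h" using less.prems(1) by (auto elim: evenE)
    have "odd h" using less.prems(2) by (auto simp: h elim: evenE)
    moreover have "h \<noteq> 1" using False h by simp
    ultimately obtain p where p: "prime p" "p dvd h" "odd p"
      by (metis prime_factor_nat dvd_trans)
    define n where "n = N div p"
    have N: "N = p * n" using p(2) by (simp add: n_def h)
    have n: "n > 0" "n < N" using N0 p(1) by (auto simp: N prime_gt_Suc_0_nat)
    have "even n" using less.prems(1) p(3) by (simp add: N)
    obtain w where w: "prime_decomposition p n w" "\<not> p dvd n \<Longrightarrow> w ^ p = 1"
      using prime_decomposition_exists[OF p(1) n(1)] by metis
    interpret prime_decomposition p n w by (rule w(1))
    define L where "L = size A"
    \<comment> \<open>Both \<open>L\<close> and \<open>p\<close> are odd, so \<open>L < p\<close>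
      improves by one; the counts below use this.\<close>
    have pL: "L + 2 \<le> p"
    proof -
      have "p \<noteq> 2" using p(3) by auto
      then have "L < p" using big[of p] p(1) by (simp add: L_def N)
      moreover have "L + 1 \<noteq> p" using p(3) less.prems(5) by (auto simp: L_def)
      ultimately show ?thesis by simp
    qed
    have bign: "L < p'" if "prime p'" "p' dvd n" "p' \<noteq> 2" for p'
      using big[of p'] that by (simp add: L_def N)
    define A' where "A' i = component w n i A" for i
    define M where "M = A + image_mset inverse A"
    define M' where "M' i = component w n i M" for i
    have A: "set_mset A \<subseteq> roots_of_unity (p * n)" using less.prems(4) by (simp add: N)
    then have M: "set_mset M \<subseteq> roots_of_unity (p * n)"
      by (auto simp: M_def roots_of_unity_def power_inverse)
    have roots: "set_mset (A' i) \<subseteq> roots_of_unity n" "set_mset (M' i) \<subseteq> roots_of_unity n" for i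
      by (simp_all add: A'_def M'_def component_roots)
    have M'0: "M' 0 = A' 0 + image_mset inverse (A' 0)"
      by (simp add: M'_def A'_def M_def component_0_inverse)
    have sizeM': "size (M' i) = size (A' i) + size (A' (p - i))" if "0 < i" "i < p" for i
      using component_inverse[of "p - i" A] that by (simp add: M'_def A'_def M_def)
    have L: "L = size (A' 0) + (\<Sum>i=1..<p. size (A' i))"
    proof -
      have "{..<p} = insert 0 {1..<p}" using p_pos by auto
      then show ?thesis using size_components[OF A] by (simp add: L_def A'_def)
    qed
    have size2: "2 * L = size (M' 0) + (\<Sum>i=1..<p. size (M' i))"
    proof -
      have "{..<p} = insert 0 {1..<p}" using p_pos by auto
      then show ?thesis using size_components[OF M] by (simp add: M_def L_def M'_def)
    qed
    show ?thesis
    proof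
      assume "(\<Sum>z\<in>#A. z + inverse z) = 0"
      then have sum0: "\<Sum>\<^sub># M = \<Sum>\<^sub># {#}" by (simp add: M_def sum_mset.distrib)
      show False
      proof (cases "\<forall>i<p. \<Sum>\<^sub># (M' i) = 0")
        case True
        \<comment> \<open>A vanishing component of odd size has more than \<open>L\<close> elements,
          but its size counts elements of \<open>A\<close> in the two components \<open>i\<close>
          and \<open>p - i\<close>, distinct as \<open>p\<close> is odd, hence is at most
          \<open>L\<close>.\<close>
        have even: "even (size (M' i))" if i: "0 < i" "i < p" for i
        proof (rule ccontr)
          assume "odd (size (M' i))"
          then have "L < size (M' i)"
            using True i roots bign n(1) by (intro odd_vanishing_sum_size[of n]) auto
          moreover have "size (A' i) + size (A' (p - i)) \<le> (\<Sum>i=1..<p. size (A' i))"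
          proof -
            have "i \<noteq> p - i" using p(3) by (metis add_diff_inverse_nat dvd_triv_left i(2) less_asym mult_2)
            then have "(\<Sum>i\<in>{i, p - i}. size (A' i)) = size (A' i) + size (A' (p - i))" by simp
            moreover have "(\<Sum>i\<in>{i, p - i}. size (A' i)) \<le> (\<Sum>i=1..<p. size (A' i))"
              using i by (intro sum_mono2) auto
            ultimately show ?thesis by simp
          qed
          ultimately show False using sizeM'[OF i] L by simp
        qed
        have "even (\<Sum>i=1..<p. size (A' i))"
          unfolding sum_reflect_halve[OF p(3)]
        proof (rule dvd_sum)
          fix i assume "i \<in> {1..p div 2}"
          then have "0 < i" "i < p" using p_pos by auto
          then show "even (size (A' i) + size (A' (p - i)))" using even sizeM' by metis
        qed
        then have "odd (size (A' 0))" using L less.prems(5) by (simp add: L_def)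
        moreover have "size (A' 0) < p'" if "prime p'" "p' dvd n" "p' \<noteq> 2" for p'
          using bign[OF that] L by simp
        moreover have "\<not> 4 dvd n" using less.prems(2) by (auto simp: N)
        ultimately have "(\<Sum>z\<in>#A' 0. z + inverse z) \<noteq> 0"
          using less.IH[OF n(2) \<open>even n\<close>] roots by blast
        moreover have "\<Sum>\<^sub># (M' 0) = 0" using True p_pos by simp
        ultimately show False by (simp add: M'0 sum_mset.distrib)
      next
        case False
        \<comment> \<open>Otherwise comparison with the empty multiset would make every component
          sum zero.\<close>
        have "\<not> p dvd n"
          using component_sums_eq[OF M _ sum0] False by (auto simp: M'_def)
        note wp = w(2)[OF this]
        define c where "c = \<Sum>\<^sub># (M' 0)"
        have c: "\<Sum>\<^sub># (M' i) = c" if "i < p" for i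
          using component_sum_diff_const[OF M _ sum0 \<open>\<not> p dvd n\<close> wp that p_pos]
          by (simp add: M'_def c_def)
        have "c \<noteq> 0" using False c by auto
        then have pos: "1 \<le> size (M' i)" if "i < p" for i
          using c[OF that] \<open>c \<noteq> 0\<close>
          by (cases "M' i = {#}") (simp_all add: Suc_le_eq flip: nonempty_has_size)
        \<comment> \<open>No component is empty, and \<open>p - 1\<close> components of two or more
          elements would exceed the \<open>2 * L\<close> elements of \<open>M\<close>.\<close>
        obtain i where i: "0 < i" "i < p" "size (M' i) = 1"
        proof -
          have "\<exists>i. 0 < i \<and> i < p \<and> size (M' i) = 1"
          proof (rule ccontr)
            assume "\<not> ?thesis"
            then have "2 \<le> size (M' i)" if "i \<in> {1..<p}" for i
              using pos[of i] that by (fastforce simp: le_Suc_eq numeral_2_eq_2)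
            then have "(\<Sum>i=1..<p. 2) \<le> (\<Sum>i=1..<p. size (M' i))" by (intro sum_mono)
            then have "2 * (p - 1) \<le> 2 * L" using size2 by simp
            then show False using pL by simp
          qed
          then show ?thesis using that by blast
        qed
        obtain y where y: "M' i = {#y#}" using i(3) by (metis size_1_singleton_mset)
        have "M' (p - i) = image_mset inverse (M' i)"
        proof -
          have "component w n (p - i) A = image_mset inverse (component w n i (image_mset inverse A))"
            using component_inverse[of i "image_mset inverse A"] i wp
            by (simp add: multiset.map_comp comp_def)
          moreover have "component w n (p - i) (image_mset inverse A) =
              image_mset inverse (component w n i A)"
            using component_inverse[of i A] i wp by simp
          ultimately show ?thesis by (simp add: M'_def M_def add.commute)
        qed
        \<comment> \<open>The components \<open>i\<close> and \<open>p - i\<close> consist of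
          \<open>y\<close> and its inverse and have the same sum \<open>c\<close>.\<close>
        then have "inverse y = y" using c[of i] c[of "p - i"] i y by simp
        moreover have "y \<noteq> 0" using c[of i] i y \<open>c \<noteq> 0\<close> by simp
        ultimately have "y\<^sup>2 = 1" by (metis power2_eq_square right_inverse)
        \<comment> \<open>Component 0 also sums to \<open>c = y\<close>, and its size is even by
          symmetry. As the other components take at least \<open>p - 1\<close> elements,
          \<open>B\<close> has at most \<open>L\<close>.\<close>
        define B where "B = add_mset (- y) (M' 0)"
        have "\<Sum>\<^sub># B = 0" using c[of i] c[of 0] i y by (simp add: B_def)
        moreover have "set_mset B \<subseteq> roots_of_unity n"
        proof -
          obtain l where "n = 2 * l" using \<open>even n\<close> by (auto elim: evenE)
          then have "(- y) ^ n = 1" using \<open>y\<^sup>2 = 1\<close> by (simp add: power_mult)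
          then show ?thesis using roots by (simp add: B_def roots_of_unity_def)
        qed
        moreover have "odd (size B)" by (simp add: B_def M'0)
        ultimately have "L < size B"
          using bign n(1) by (intro odd_vanishing_sum_size[of n]) auto
        moreover have "(\<Sum>i=1..<p. 1) \<le> (\<Sum>i=1..<p. size (M' i))" using pos by (intro sum_mono) auto
        then have "size (M' 0) + (p - 1) \<le> 2 * L" using size2 by simp
        ultimately show False using pL by (simp add: B_def)
      qed
    qed
  qed
qed

section \<open>Eigenvalues of the torus graph\<close>

text \<open>For nonzero \<open>e\<close>, counting roots gives some \<open>w\<close> with
  \<open>w powi e\<close> different from 1, and multiplication by \<open>w\<close> permutes the
  roots while scaling the sum.\<close>

lemma sum_power_int_roots_of_unity:
  assumes "\<bar>e\<bar> < int N"
  shows "(\<Sum>z\<in>roots_of_unity N. z powi e) = (if e = 0 then of_nat N else 0)"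
proof (cases "e = 0")
  case True
  then show ?thesis using assms by (simp add: roots_of_unity_def card_roots_unity_eq)
next
  case False
  have N: "N > 0" using assms by simp
  have nz: "z \<noteq> 0" if "z \<in> roots_of_unity N" for z
    using that N by (auto simp: roots_of_unity_def zero_power)
  define k where "k = nat \<bar>e\<bar>"
  have k: "k > 0" "k < N" using False assms by (auto simp: k_def)
  have "\<not> {z::complex. z ^ N = 1} \<subseteq> {z. z ^ k = 1}"
  proof
    assume "{z::complex. z ^ N = 1} \<subseteq> {z. z ^ k = 1}"
    then have "card {z::complex. z ^ N = 1} \<le> card {z::complex. z ^ k = 1}"
      using k by (intro card_mono finite_roots_unity) auto
    then show False using k by (simp add: card_roots_unity_eq)
  qed
  then obtain w :: complex where w: "w \<in> roots_of_unity N" "w ^ k \<noteq> 1"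
    by (auto simp: roots_of_unity_def)
  have "w powi e \<noteq> 1"
    using w(2) by (cases "e \<ge> 0") (auto simp: k_def power_int_def power_inverse)
  have "(\<Sum>z\<in>roots_of_unity N. z powi e) = (\<Sum>z\<in>roots_of_unity N. (w * z) powi e)"
    using nz[OF w(1)] w(1)
    by (intro sum.reindex_bij_witness[of _ "\<lambda>z. w * z" "\<lambda>z. z / w"])
      (auto simp: roots_of_unity_def power_mult_distrib power_divide)
  also have "\<dots> = w powi e * (\<Sum>z\<in>roots_of_unity N. z powi e)"
    by (simp add: power_int_mult_distrib sum_distrib_left)
  finally show ?thesis using \<open>w powi e \<noteq> 1\<close> False by simp
qed

lemma power_int_mod:
  fixes z :: complex
  assumes "z \<in> roots_of_unity N" "N > 0"
  shows "z powi (a mod int N) = z powi a"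
proof -
  have "z \<noteq> 0" using assms by (auto simp: roots_of_unity_def zero_power)
  have "z powi a = z powi (int N * (a div int N) + a mod int N)" by simp
  also have "\<dots> = (z powi int N) powi (a div int N) * z powi (a mod int N)"
    by (simp only: power_int_add[OF disjI1[OF \<open>z \<noteq> 0\<close>]] power_int_mult)
  finally show ?thesis using assms(1) by (simp add: roots_of_unity_def)
qed

locale torus =
  fixes d N :: nat
  assumes N3: "N \<ge> 3"
begin

definition vertices :: "(nat \<Rightarrow> int) set" where
  "vertices = (\<Pi>\<^sub>E i\<in>{1..d}. {0..<int N})"

definition shift :: "(nat \<Rightarrow> int) \<Rightarrow> nat \<Rightarrow> int \<Rightarrow> nat \<Rightarrow> int" where
  "shift x i e = (\<lambda>j\<in>{1..d}. (x j + (if j = i then e else 0)) mod int N)"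

lemma pverts: "pverts (torus_graph d N) = vertices"
  using N3 by (simp add: torus_graph_def cayley_graph_def torus_group_def vertices_def
      carrier_integer_mod_group)

lemma finite_vertices: "finite vertices"
  by (auto simp: vertices_def intro!: finite_PiE)

lemma shift_in_vertices: "shift x i e \<in> vertices"
  using N3 by (auto simp: shift_def vertices_def)

lemma shift_inverse:
  assumes "x \<in> vertices"
  shows "shift (shift x i e) i (- e) = x"
proof
  fix j
  show "shift (shift x i e) i (- e) j = x j"
  proof (cases "j \<in> {1..d}")
    case True
    then have "x j mod int N = x j" using assms by (auto simp: vertices_def PiE_iff)
    then show ?thesis using True by (cases "j = i") (simp_all add: shift_def mod_simps)
  next
    case False
    then show ?thesis using assms by (auto simp: shift_def vertices_def PiE_iff extensional_def)
  qed
qed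

lemma neighbours:
  assumes x: "x \<in> vertices"
  shows "{y \<in> pverts (torus_graph d N). (x, y) \<in> parcs (torus_graph d N)} =
    (\<lambda>(i, e). shift x i e) ` ({1..d} \<times> {1, -1})"
proof -
  let ?G = "torus_group d N"
  have basis: "basis_vector d i \<in> carrier ?G" for i
    using N3 by (auto simp: basis_vector_def torus_group_def carrier_integer_mod_group)
  have 1: "x \<otimes>\<^bsub>?G\<^esub> basis_vector d i = shift x i 1" for i
    by (auto simp: torus_group_def basis_vector_def shift_def fun_eq_iff)
  have "inv\<^bsub>?G\<^esub> (basis_vector d i) =
      (\<lambda>j\<in>{1..d}. inv\<^bsub>integer_mod_group N\<^esub> (basis_vector d i j))" for i
    using basis[of i] unfolding torus_group_def by (subst inv_product_group) auto
  then have inv: "inv\<^bsub>?G\<^esub> (basis_vector d i) = (\<lambda>j\<in>{1..d}. (- basis_vector d i j) mod int N)" for i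
    using N3 by (auto simp: fun_eq_iff basis_vector_def)
  have 2: "x \<otimes>\<^bsub>?G\<^esub> inv\<^bsub>?G\<^esub> (basis_vector d i) = shift x i (-1)" for i
    unfolding inv by (auto simp: torus_group_def basis_vector_def shift_def fun_eq_iff mod_simps)
  have "x \<in> carrier ?G" using x pverts by (simp add: torus_graph_def cayley_graph_def)
  then have "(x, y) \<in> parcs (torus_graph d N) \<longleftrightarrow> (\<exists>i\<in>{1..d}.
      y = x \<otimes>\<^bsub>?G\<^esub> basis_vector d i \<or> y = x \<otimes>\<^bsub>?G\<^esub> inv\<^bsub>?G\<^esub> (basis_vector d i))" for y
    unfolding torus_graph_def cayley_graph_def by auto
  then have "(x, y) \<in> parcs (torus_graph d N) \<longleftrightarrow> (\<exists>i\<in>{1..d}. y = shift x i 1 \<or> y = shift x i (-1))" for y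
    by (simp only: 1 2)
  then show ?thesis using shift_in_vertices pverts by auto
qed

text \<open>Here \<open>N \<ge> 3\<close> is essential: 0, 1 and -1 are distinct modulo
  \<open>N\<close>, so the generators do not coincide and the 0-1 adjacency matrix loses no
  multiplicities.\<close>

lemma inj_on_shift:
  assumes x: "x \<in> vertices"
  shows "inj_on (\<lambda>(i, e). shift x i e) ({1..d} \<times> {1, -1})"
proof (rule inj_onI, clarify)
  fix i e i' e'
  assume i: "i \<in> {1..d}" and i': "i' \<in> {1..d}" and e: "e \<in> {1, -1}" and e': "e' \<in> {1, -1}"
    and eq: "shift x i e = shift x i' e'"
  have range: "0 \<le> x i" "x i < int N" using x i by (auto simp: vertices_def PiE_iff)
  have *: "a = b" if "(x i + a) mod int N = (x i + b) mod int N" "a \<in> {-1, 0, 1}" "b \<in> {-1, 0, 1}" for a b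
  proof -
    have "int N dvd a - b" using that(1) by (metis add_diff_cancel_left mod_eq_dvd_iff)
    moreover have "\<bar>a - b\<bar> < int N" using that(2,3) N3 by auto
    ultimately show ?thesis using dvd_imp_le_int[of "a - b" "int N"] by auto
  qed
  have "shift x i e i = shift x i' e' i" by (simp only: eq)
  then have "(x i + e) mod int N = (x i + (if i = i' then e' else 0)) mod int N"
    using i by (simp add: shift_def)
  then have "e = (if i = i' then e' else 0)"
    by (rule *) (use e e' in auto)
  then show "i = i' \<and> e = e'" using e by (cases "i = i'") auto
qed

lemma sum_neighbours:
  assumes "x \<in> vertices"
  shows "(\<Sum>y | y \<in> pverts (torus_graph d N) \<and> (x, y) \<in> parcs (torus_graph d N). f y) =
    (\<Sum>i=1..d. f (shift x i 1) + f (shift x i (-1)) :: complex)"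
proof -
  have "(\<Sum>y | y \<in> pverts (torus_graph d N) \<and> (x, y) \<in> parcs (torus_graph d N). f y) =
      (\<Sum>(i, e)\<in>{1..d} \<times> {1, -1}. f (shift x i e))"
    unfolding neighbours[OF assms] sum.reindex[OF inj_on_shift[OF assms]]
    by (simp add: case_prod_unfold)
  also have "\<dots> = (\<Sum>i=1..d. \<Sum>e\<in>{1, -1}. f (shift x i e))"
    by (rule sum.cartesian_product[symmetric])
  finally show ?thesis by simp
qed

definition character :: "(nat \<Rightarrow> complex) \<Rightarrow> (nat \<Rightarrow> int) \<Rightarrow> complex" where
  "character u x = (\<Prod>j=1..d. u j powi x j)"

lemma root_nonzero: "z \<in> roots_of_unity N \<Longrightarrow> z \<noteq> 0"
  using N3 by (auto simp: roots_of_unity_def zero_power)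

lemma character_shift:
  assumes "\<And>j. j \<in> {1..d} \<Longrightarrow> u j \<in> roots_of_unity N" "i \<in> {1..d}"
  shows "character u (shift x i e) = u i powi e * character u x"
proof -
  have "character u (shift x i e) = (\<Prod>j=1..d. u j powi (x j + (if j = i then e else 0)))"
    unfolding character_def using assms N3 by (intro prod.cong) (auto simp: shift_def power_int_mod)
  also have "\<dots> = (\<Prod>j=1..d. u j powi x j * (if j = i then u i powi e else 1))"
    using assms root_nonzero by (intro prod.cong refl) (auto simp: power_int_add)
  finally show ?thesis using assms(2) by (simp add: character_def prod.distrib mult.commute)
qed

text \<open>The sum over all characters factors into one sum over \<open>N\<close>-th roots of unity
  per coordinate.\<close>

lemma character_orthogonality:
  assumes "x \<in> vertices" "y \<in> vertices"
  shows "(\<Sum>u\<in>(\<Pi>\<^sub>E j\<in>{1..d}. roots_of_unity N). character u x / character u y) =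
    (if x = y then of_nat N ^ d else 0)"
proof -
  have fin: "finite (roots_of_unity N)"
    using N3 by (auto simp: roots_of_unity_def intro!: finite_roots_unity)
  have "(\<Sum>u\<in>(\<Pi>\<^sub>E j\<in>{1..d}. roots_of_unity N). character u x / character u y) =
      (\<Sum>u\<in>(\<Pi>\<^sub>E j\<in>{1..d}. roots_of_unity N). \<Prod>j=1..d. u j powi (x j - y j))"
  proof (intro sum.cong refl)
    fix u :: "nat \<Rightarrow> complex" assume u: "u \<in> (\<Pi>\<^sub>E j\<in>{1..d}. roots_of_unity N)"
    have "character u x / character u y = (\<Prod>j=1..d. u j powi x j / u j powi y j)"
      by (simp add: character_def prod_dividef)
    also have "\<dots> = (\<Prod>j=1..d. u j powi (x j - y j))"
      using u root_nonzero by (intro prod.cong refl) (auto simp: power_int_diff PiE_iff)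
    finally show "character u x / character u y = \<dots>" .
  qed
  also have "\<dots> = (\<Prod>j=1..d. \<Sum>z\<in>roots_of_unity N. z powi (x j - y j))"
    using fin by (intro prod_sum_PiE[symmetric]) auto
  also have "\<dots> = (\<Prod>j=1..d. if x j = y j then of_nat N else 0)"
  proof (intro prod.cong refl)
    fix j assume "j \<in> {1..d}"
    then have "\<bar>x j - y j\<bar> < int N" using assms by (force simp: vertices_def PiE_iff)
    then show "(\<Sum>z\<in>roots_of_unity N. z powi (x j - y j)) = (if x j = y j then of_nat N else 0)"
      by (simp add: sum_power_int_roots_of_unity)
  qed
  also have "\<dots> = (if x = y then of_nat N ^ d else 0)"
  proof (cases "x = y")
    case False
    then obtain j where "j \<in> {1..d}" "x j \<noteq> y j"
      using assms PiE_ext[of x "{1..d}" _ y] unfolding vertices_def by blast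
    then show ?thesis using False by (auto simp: prod_zero_iff)
  qed simp
  finally show ?thesis .
qed

lemma eigenvalueI:
  assumes u: "\<And>j. j \<in> {1..d} \<Longrightarrow> u j \<in> roots_of_unity N"
  shows "graph_eigenvalue (torus_graph d N) (\<Sum>j=1..d. u j + inverse (u j))"
proof -
  obtain vs where vs: "distinct vs" "set vs = pverts (torus_graph d N)"
    using finite_distinct_list[OF finite_vertices] pverts by metis
  have nz: "character u x \<noteq> 0" for x
    using u root_nonzero by (auto simp: character_def)
  have "(\<Sum>i=1..d. character u (shift x i 1) + character u (shift x i (-1))) =
      (\<Sum>j=1..d. u j + inverse (u j)) * character u x" for x
    using character_shift[OF u] by (simp add: sum_distrib_right distrib_right power_int_minus)
  \<comment> \<open>The character itself is the eigenfunction. The instance of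
    \<open>shift_in_vertices\<close> with arbitrary arguments supplies a vertex where it is
    nonzero.\<close>
  then have "eigenvalue (adjacency_matrix (torus_graph d N) vs) (\<Sum>j=1..d. u j + inverse (u j))"
    unfolding eigenvalue_adjacency_matrix_iff[OF vs]
    using nz shift_in_vertices[of undefined undefined undefined] sum_neighbours pverts
    by (intro exI[of _ "character u"]) auto
  then show ?thesis using vs by (auto simp: graph_eigenvalue_def)
qed

text \<open>No diagonalisation is carried out: a nonzero Fourier coefficient \<open>F u\<close> of
  an eigenfunction suffices, since the transformed eigenvalue equation multiplies \<open>F u\<close>
  by \<open>k\<close> and by the character sum.\<close>

lemma eigenvalueD:
  assumes "graph_eigenvalue (torus_graph d N) k"
  obtains u where "u \<in> {1..d} \<rightarrow> roots_of_unity N" "k = (\<Sum>j=1..d. u j + inverse (u j))"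
proof -
  obtain vs where vs: "distinct vs" "set vs = pverts (torus_graph d N)"
    and "eigenvalue (adjacency_matrix (torus_graph d N) vs) k"
    using assms by (auto simp: graph_eigenvalue_def)
  then obtain f where f0: "\<exists>x\<in>vertices. f x \<noteq> 0"
    and nbr: "\<forall>x\<in>vertices. (\<Sum>y | y \<in> vertices \<and> (x, y) \<in> parcs (torus_graph d N). f y) = k * f x"
    unfolding eigenvalue_adjacency_matrix_iff[OF vs] pverts by blast
  have f: "(\<Sum>i=1..d. f (shift x i 1) + f (shift x i (-1))) = k * f x" if "x \<in> vertices" for x
    using nbr that sum_neighbours[OF that, of f] by (simp add: pverts)
  obtain x0 where x0: "x0 \<in> vertices" "f x0 \<noteq> 0" using f0 by blast
  define F where "F u = (\<Sum>x\<in>vertices. f x * character u x)" for u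
  let ?U = "\<Pi>\<^sub>E j\<in>{1..d}. roots_of_unity N"
  \<comment> \<open>If all coefficients vanished, Fourier inversion at \<open>x0\<close> would give
    \<open>f x0 = 0\<close>.\<close>
  have "\<exists>u\<in>?U. F u \<noteq> 0"
  proof (rule ccontr)
    assume "\<not> ?thesis"
    then have "0 = (\<Sum>u\<in>?U. F u / character u x0)" by simp
    also have "\<dots> = (\<Sum>x\<in>vertices. f x * (\<Sum>u\<in>?U. character u x / character u x0))"
      unfolding F_def sum_divide_distrib sum_distrib_left by (subst sum.swap) simp
    also have "\<dots> = (\<Sum>x\<in>vertices. if x = x0 then f x0 * of_nat N ^ d else 0)"
      using character_orthogonality x0(1) by (intro sum.cong) auto
    also have "\<dots> = f x0 * of_nat N ^ d" using x0(1) finite_vertices by simp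
    finally show False using x0(2) N3 by simp
  qed
  then obtain u where "u \<in> ?U" and F: "F u \<noteq> 0" by blast
  then have u: "\<And>j. j \<in> {1..d} \<Longrightarrow> u j \<in> roots_of_unity N" by (auto simp: PiE_iff)
  have shifted: "(\<Sum>x\<in>vertices. f (shift x i e) * character u x) = u i powi (- e) * F u"
    if i: "i \<in> {1..d}" for i e
  proof -
    have char: "character u (shift y i (- e)) = u i powi (- e) * character u y" for y
      by (rule character_shift) (use u i in auto)
    have "(\<Sum>x\<in>vertices. f (shift x i e) * character u x) =
        (\<Sum>y\<in>vertices. f y * character u (shift y i (- e)))"
      using shift_inverse shift_inverse[of _ i "- e"] shift_in_vertices
      by (intro sum.reindex_bij_witness[of _ "\<lambda>y. shift y i (- e)" "\<lambda>x. shift x i e"]) auto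
    also have "\<dots> = u i powi (- e) * F u"
      by (simp only: char F_def sum_distrib_left mult.left_commute)
    finally show ?thesis .
  qed
  have "k * F u = (\<Sum>x\<in>vertices. (\<Sum>i=1..d. f (shift x i 1) + f (shift x i (-1))) * character u x)"
    using f by (simp add: F_def sum_distrib_left mult.assoc)
  also have "\<dots> = (\<Sum>i=1..d. (\<Sum>x\<in>vertices. f (shift x i 1) * character u x) +
      (\<Sum>x\<in>vertices. f (shift x i (-1)) * character u x))"
    by (simp only: sum_distrib_right distrib_right sum.distrib) (simp only: sum.swap[of _ vertices])
  also have "\<dots> = (\<Sum>j=1..d. u j + inverse (u j)) * F u"
    using shifted by (simp add: sum_distrib_right distrib_right power_int_minus add.commute)
  finally have "k = (\<Sum>j=1..d. u j + inverse (u j))" using F by simp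
  then show ?thesis using u by (intro that[of u]) auto
qed

end

section \<open>Building blocks for symmetric sums\<close>

text \<open>A general value \<open>k\<close> is allowed because length and value are both additive,
  so blocks of nonzero value can be combined to reach 0.\<close>

definition realizable :: "nat \<Rightarrow> nat \<Rightarrow> complex \<Rightarrow> bool" where
  "realizable N n k \<longleftrightarrow> (\<exists>A. size A = n \<and> set_mset A \<subseteq> roots_of_unity N \<and>
    (\<Sum>z\<in>#A. z + inverse z) = k)"

lemma torus_eigenvalue_iff:
  assumes "N \<ge> 3"
  shows "graph_eigenvalue (torus_graph d N) k \<longleftrightarrow> realizable N d k"
proof -
  interpret torus d N using assms by unfold_locales
  show ?thesis
  proof
    assume "graph_eigenvalue (torus_graph d N) k"
    then obtain u where u: "u \<in> {1..d} \<rightarrow> roots_of_unity N"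
      "k = (\<Sum>j=1..d. u j + inverse (u j))" by (rule eigenvalueD)
    define A where "A = image_mset u (mset_set {1..d})"
    have "size A = d" by (simp add: A_def)
    moreover have "set_mset A \<subseteq> roots_of_unity N" using u(1) by (auto simp: A_def)
    moreover have "(\<Sum>z\<in>#A. z + inverse z) = k"
      by (simp add: A_def u(2) multiset.map_comp comp_def sum_unfold_sum_mset)
    ultimately show "realizable N d k" unfolding realizable_def by blast
  next
    assume "realizable N d k"
    then obtain A where A: "size A = d" "set_mset A \<subseteq> roots_of_unity N"
      "(\<Sum>z\<in>#A. z + inverse z) = k" unfolding realizable_def by blast
    obtain zs where zs: "mset zs = A" using ex_mset by blast
    have len: "length zs = d" using A(1) zs by auto
    have "k = (\<Sum>z\<leftarrow>zs. z + inverse z)" using A(3) zs by (metis mset_map sum_mset_sum_list)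
    also have "\<dots> = (\<Sum>j<d. zs ! j + inverse (zs ! j))"
      by (simp add: sum_list_sum_nth len atLeast0LessThan)
    also have "\<dots> = (\<Sum>j=1..d. zs ! (j - 1) + inverse (zs ! (j - 1)))"
      by (rule sum.reindex_bij_witness[of _ "\<lambda>j. j - 1" "\<lambda>j. j + 1"]) auto
    finally have k: "k = (\<Sum>j=1..d. zs ! (j - 1) + inverse (zs ! (j - 1)))" .
    have "zs ! (j - 1) \<in> roots_of_unity N" if "j \<in> {1..d}" for j
    proof -
      have "zs ! (j - 1) \<in> set zs" using that len by (intro nth_mem) auto
      then show ?thesis using A(2) zs by auto
    qed
    then show "graph_eigenvalue (torus_graph d N) k" unfolding k by (rule eigenvalueI)
  qed
qed

lemma realizable_0: "realizable N 0 0"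
  unfolding realizable_def by (intro exI[of _ "{#}"]) simp

lemma realizable_add:
  assumes "realizable N m x" "realizable N n y"
  shows "realizable N (m + n) (x + y)"
proof -
  obtain A where "size A = m" "set_mset A \<subseteq> roots_of_unity N" "(\<Sum>z\<in>#A. z + inverse z) = x"
    using assms(1) unfolding realizable_def by blast
  moreover obtain B where "size B = n" "set_mset B \<subseteq> roots_of_unity N" "(\<Sum>z\<in>#B. z + inverse z) = y"
    using assms(2) unfolding realizable_def by blast
  ultimately show ?thesis unfolding realizable_def by (intro exI[of _ "A + B"]) simp
qed

lemma realizable_mult: "realizable N m x \<Longrightarrow> realizable N (k * m) (of_nat k * x)"
  by (induction k) (auto simp: realizable_0 distrib_right dest: realizable_add)

lemma realizable_sum:
  assumes "\<And>i. i \<in> I \<Longrightarrow> realizable N (f i) (g i)"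
  shows "realizable N (\<Sum>i\<in>I. f i) (\<Sum>i\<in>I. g i)"
  using assms
  by (induction I rule: infinite_finite_induct) (auto simp: realizable_0 realizable_add)

lemma realizable_one: "realizable N 1 2"
  unfolding realizable_def by (intro exI[of _ "{#1#}"]) (simp add: roots_of_unity_def)

lemma realizable_two: "even N \<Longrightarrow> realizable N 2 0"
  unfolding realizable_def by (intro exI[of _ "{#1, -1#}"]) (simp add: roots_of_unity_def)

lemma realizable_imaginary: "4 dvd N \<Longrightarrow> realizable N 1 0"
  unfolding realizable_def
  by (intro exI[of _ "{#\<i>#}"]) (auto simp: roots_of_unity_def power_mult elim!: dvdE)

text \<open>One root from each inverse pair of nontrivial \<open>p\<close>-th roots is taken; with
  the inverses they are all nontrivial roots, whose sum is -1.\<close>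

lemma realizable_half_prime:
  assumes "prime p" "odd p" "p dvd N"
  shows "realizable N (p div 2) (- 1)"
proof -
  obtain w where "prime_decomposition p 1 w" "\<not> p dvd 1 \<Longrightarrow> w ^ p = 1"
    using prime_decomposition_exists[OF assms(1), of 1] by auto
  then have w: "w ^ p = 1" "w \<noteq> 1" using assms(1) by (auto simp: prime_decomposition_def)
  have w0: "w \<noteq> 0" using w(1) prime_gt_0_nat[OF assms(1)] by (auto simp: zero_power)
  define A where "A = image_mset (\<lambda>i. w ^ i) (mset_set {1..p div 2})"
  have "w ^ i \<in> roots_of_unity p" for i
    using w(1) by (simp add: roots_of_unity_def mult.commute[of i] power_mult flip: power_mult[of w i p])
  then have "set_mset A \<subseteq> roots_of_unity N"
    using roots_of_unity_mono[OF assms(3)] by (auto simp: A_def)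
  moreover have "(\<Sum>z\<in>#A. z + inverse z) = - 1"
  proof -
    have "(\<Sum>z\<in>#A. z + inverse z) = (\<Sum>i=1..p div 2. w ^ i + inverse (w ^ i))"
      by (simp add: A_def multiset.map_comp comp_def sum_unfold_sum_mset)
    also have "\<dots> = (\<Sum>i=1..p div 2. w ^ i + w ^ (p - i))"
    proof (intro sum.cong refl)
      fix i assume "i \<in> {1..p div 2}"
      then have "i + (p - i) = p" by auto
      then have "w ^ i * w ^ (p - i) = 1" using w(1) by (metis power_add)
      then show "w ^ i + inverse (w ^ i) = w ^ i + w ^ (p - i)" by (simp add: inverse_unique)
    qed
    also have "\<dots> = (\<Sum>i=1..<p. w ^ i)" by (rule sum_reflect_halve[OF assms(2), symmetric])
    also have "\<dots> = (\<Sum>i<p. w ^ i) - 1"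
    proof -
      have "{..<p} = insert 0 {1..<p}" using prime_gt_0_nat[OF assms(1)] by auto
      then show ?thesis by simp
    qed
    also have "\<dots> = - 1" using sum_powers_root_unity[OF w(1)] w(2) by simp
    finally show ?thesis .
  qed
  moreover have "size A = p div 2" by (simp add: A_def)
  ultimately show ?thesis unfolding realizable_def by blast
qed

text \<open>The multiset together with its inverses is a vanishing sum of length
  \<open>2 * d\<close>, to which Lam--Leung applies.\<close>

lemma realizable_imp_semigroup:
  assumes "nat_semigroup S" "N > 0" "\<And>p. prime p \<Longrightarrow> p dvd N \<Longrightarrow> p \<in> S" "realizable N d 0"
  shows "2 * d \<in> S"
proof -
  obtain A where A: "size A = d" "set_mset A \<subseteq> roots_of_unity N" "(\<Sum>z\<in>#A. z + inverse z) = 0"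
    using assms(4) unfolding realizable_def by blast
  have "size (A + image_mset inverse A) \<in> S"
  proof (rule nat_semigroup.lam_leung[OF assms(1,2,3)])
    show "set_mset (A + image_mset inverse A) \<subseteq> roots_of_unity N"
      using A(2) by (auto simp: roots_of_unity_def power_inverse)
    show "\<Sum>\<^sub># (A + image_mset inverse A) = 0" using A(3) by (simp add: sum_mset.distrib)
  qed
  then show ?thesis using A(1) by (simp add: mult_2)
qed

lemma not_realizable_odd:
  assumes "even N" "\<not> 4 dvd N" "odd d" "\<And>p. prime p \<Longrightarrow> p dvd N \<Longrightarrow> p \<noteq> 2 \<Longrightarrow> d < p"
  shows "\<not> realizable N d 0"
  using odd_symmetric_sum_nonzero[of N] assms unfolding realizable_def by blast

section \<open>The eigenvalue zero according to the parity of \<open>N\<close> and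
  \<open>d\<close>\<close>

theorem proposition4p1:
  fixes d N s :: nat and p a :: "nat \<Rightarrow> nat"
  assumes "d \<ge> 1" and "N \<ge> 3"
    and "N = (\<Prod>l=1..s. p l ^ a l)"
    and "\<forall>l\<in>{1..s}. prime (p l)"
    and "strict_mono_on {1..s} p"
    and "\<forall>l\<in>{1..s}. a l \<ge> 1"
  shows "(\<not> 2 dvd N \<longrightarrow>
            (graph_eigenvalue (torus_graph d N) 0 \<longleftrightarrow>
               2 * d \<in> range (\<lambda>b :: nat \<Rightarrow> nat. \<Sum>l=1..s. b l * p l))) \<and>
         (2 dvd N \<and> even d \<longrightarrow> graph_eigenvalue (torus_graph d N) 0) \<and>
         (2 dvd N \<and> odd d \<and> s \<ge> 2 \<and> p 2 \<le> d \<longrightarrow>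
            graph_eigenvalue (torus_graph d N) 0) \<and>
         (2 dvd N \<and> odd d \<and> s \<ge> 2 \<and> p 2 > d \<longrightarrow>
            (graph_eigenvalue (torus_graph d N) 0 \<longleftrightarrow> 4 dvd N))"
proof -
  note eig = torus_eigenvalue_iff[OF assms(2)]
  have N0: "N > 0" using assms(2) by simp
  have dvd: "p l dvd N" if "l \<in> {1..s}" for l
  proof -
    have "a l \<ge> 1" using assms(6) that by blast
    then have "p l dvd p l ^ a l" by (intro dvd_power) auto
    also have "\<dots> dvd N" unfolding assms(3) using that by (intro dvd_prodI) auto
    finally show ?thesis .
  qed
  have ex: "\<exists>l\<in>{1..s}. q = p l" if q: "prime q" "q dvd N" for q
  proof -
    obtain l where l: "l \<in> {1..s}" "q dvd p l ^ a l"
      using q unfolding assms(3) by (auto simp: prime_dvd_prod_iff)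
    then have "q dvd p l" using q(1) prime_dvd_power by blast
    then show ?thesis using l(1) q(1) assms(4) primes_dvd_imp_eq by blast
  qed
  let ?S = "range (\<lambda>b :: nat \<Rightarrow> nat. \<Sum>l=1..s. b l * p l)"
  have "graph_eigenvalue (torus_graph d N) 0 \<longleftrightarrow> 2 * d \<in> ?S" if "\<not> 2 dvd N"
  proof
    interpret nat_semigroup ?S
    proof
      show "0 \<in> ?S" by (rule range_eqI[of _ _ "\<lambda>_. 0"]) simp
      fix m n assume "m \<in> ?S" "n \<in> ?S"
      then obtain b c where "m = (\<Sum>l=1..s. b l * p l)" "n = (\<Sum>l=1..s. c l * p l)" by blast
      then show "m + n \<in> ?S"
        by (intro range_eqI[of _ _ "\<lambda>l. b l + c l"]) (simp add: distrib_right sum.distrib)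
    qed
    assume "graph_eigenvalue (torus_graph d N) 0"
    moreover have "q \<in> ?S" if q: "prime q" "q dvd N" for q
    proof -
      obtain l where "l \<in> {1..s}" "q = p l" using ex[OF q] by blast
      moreover have "(\<Sum>k=1..s. (if k = l then 1 else 0) * p k) = (\<Sum>k=1..s. if k = l then p k else 0)"
        by (intro sum.cong) auto
      ultimately show ?thesis by (intro range_eqI[of _ _ "\<lambda>k. if k = l then 1 else 0"]) simp
    qed
    ultimately show "2 * d \<in> ?S"
      unfolding eig by (intro realizable_imp_semigroup[OF nat_semigroup_axioms N0])
  next
    assume "2 * d \<in> ?S"
    then obtain b where b: "2 * d = (\<Sum>l=1..s. b l * p l)" by blast
    have odd: "odd (p l)" if "l \<in> {1..s}" for l
      using dvd[OF that] \<open>\<not> 2 dvd N\<close> by (meson dvd_trans)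
    \<comment> \<open>Each \<open>p l\<close> is \<open>1 + 2 * (p l div 2)\<close>, so the
      \<open>b l\<close> have an even sum \<open>2 * e\<close> and \<open>d = e + h\<close>. The
      \<open>e\<close> copies of the root 1 contribute \<open>2 * e\<close>, and the half systems of
      roots contribute \<open>- 2 * e\<close>.\<close>
    define h where "h = (\<Sum>l=1..s. b l * (p l div 2))"
    have "(\<Sum>l=1..s. b l * p l) = (\<Sum>l=1..s. b l + 2 * (b l * (p l div 2)))"
    proof (intro sum.cong refl)
      fix l assume "l \<in> {1..s}"
      then have "p l = 1 + 2 * (p l div 2)" using odd by simp
      then show "b l * p l = b l + 2 * (b l * (p l div 2))"
        by (metis distrib_left mult.left_commute mult.right_neutral)
    qed
    then have d: "2 * d = (\<Sum>l=1..s. b l) + 2 * h"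
      by (simp add: b h_def sum.distrib sum_distrib_left)
    then obtain e where e: "(\<Sum>l=1..s. b l) = 2 * e" by (metis dvd_add_left_iff dvd_triv_left dvdE)
    have "realizable N (e * 1) (of_nat e * 2)" by (intro realizable_mult realizable_one)
    moreover have "realizable N h (\<Sum>l=1..s. of_nat (b l) * (- 1))"
      unfolding h_def using dvd odd assms(4)
      by (intro realizable_sum realizable_mult realizable_half_prime) auto
    ultimately have "realizable N (e * 1 + h) (of_nat e * 2 + (\<Sum>l=1..s. of_nat (b l) * (- 1)))"
      by (rule realizable_add)
    moreover have "e * 1 + h = d" using d e by simp
    moreover have "of_nat e * 2 + (\<Sum>l=1..s. of_nat (b l) * (- 1)) = (0 :: complex)"
    proof -
      have "(\<Sum>l=1..s. of_nat (b l) * (- 1)) = - (of_nat (\<Sum>l=1..s. b l) :: complex)"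
        by (simp add: sum_negf)
      also have "\<dots> = - (of_nat e * 2)" unfolding e by simp
      finally show ?thesis by (simp only: add.right_inverse)
    qed
    ultimately show "graph_eigenvalue (torus_graph d N) 0" unfolding eig by metis
  qed
  moreover have "graph_eigenvalue (torus_graph d N) 0" if "2 dvd N" "even d"
  proof -
    have "realizable N (d div 2 * 2) (of_nat (d div 2) * 0)"
      by (intro realizable_mult realizable_two that)
    then show ?thesis using that by (simp add: eig)
  qed
  \<comment> \<open>For even \<open>N\<close> the smallest prime \<open>p 1\<close> is 2, so
    \<open>p 2\<close> is the smallest odd prime divisor.\<close>
  moreover have p2: "prime (p 2)" "odd (p 2)" "p 2 dvd N" "\<And>q. prime q \<Longrightarrow> q dvd N \<Longrightarrow> q \<noteq> 2 \<Longrightarrow> p 2 \<le> q"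
    if N2: "2 dvd N" and s: "s \<ge> 2"
  proof -
    have mono: "p i < p j" if "1 \<le> i" "i < j" "j \<le> s" for i j
      using strict_mono_onD[OF assms(5), of i j] that by simp
    obtain l where l: "l \<in> {1..s}" "2 = p l" using ex[of 2] N2 by auto
    have p1: "p 1 = 2"
    proof (cases "l = 1")
      case False
      then have "p 1 < 2" using mono[of 1 l] l by simp
      moreover have "p 1 \<ge> 2" using assms(4) s by (intro prime_ge_2_nat) auto
      ultimately show ?thesis by simp
    qed (use l in simp)
    show pr: "prime (p 2)" and "p 2 dvd N" using assms(4) dvd s by auto
    have "p 2 > 2" using mono[of 1 2] s p1 by simp
    then show "odd (p 2)" using pr prime_odd_nat by blast
    fix q assume q: "prime q" "q dvd N" "q \<noteq> 2"
    then obtain k where k: "k \<in> {1..s}" "q = p k" using ex by blast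
    then have "k \<noteq> 1" using p1 q(3) by auto
    then show "p 2 \<le> q" using mono[of 2 k] k by (cases "k = 2") auto
  qed
  moreover have "graph_eigenvalue (torus_graph d N) 0"
    if "2 dvd N" "odd d" "s \<ge> 2" "p 2 \<le> d"
  proof -
    note p2 = p2[OF that(1,3)]
    \<comment> \<open>The root 1 gives 2, two half systems of \<open>p 2\<close>-th roots give -2,
      and together they have length \<open>p 2\<close>. The even remainder \<open>d - p 2\<close> is
      filled with pairs of value 0.\<close>
    have "realizable N (1 + 2 * (p 2 div 2) + (d - p 2) div 2 * 2)
        (2 + of_nat 2 * (- 1) + of_nat ((d - p 2) div 2) * 0)"
      by (intro realizable_add realizable_one realizable_mult realizable_half_prime realizable_two
          p2 that)
    moreover have "1 + 2 * (p 2 div 2) + (d - p 2) div 2 * 2 = d"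
      using p2(2) that(2,4) by presburger
    ultimately show ?thesis by (simp add: eig)
  qed
  moreover have "graph_eigenvalue (torus_graph d N) 0 \<longleftrightarrow> 4 dvd N"
    if "2 dvd N" "odd d" "s \<ge> 2" "p 2 > d"
  proof
    assume "4 dvd N"
    then have "realizable N (d * 1) (of_nat d * 0)"
      by (intro realizable_mult realizable_imaginary)
    then show "graph_eigenvalue (torus_graph d N) 0" by (simp add: eig)
  next
    assume "graph_eigenvalue (torus_graph d N) 0"
    then have "realizable N d 0" by (simp add: eig)
    moreover have "d < q" if "prime q" "q dvd N" "q \<noteq> 2" for q
      using p2(4)[OF \<open>2 dvd N\<close> \<open>s \<ge> 2\<close> that] \<open>p 2 > d\<close> by simp
    ultimately show "4 dvd N" using not_realizable_odd that(1,2) by blast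
  qed
  ultimately show ?thesis by blast
qed

end
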